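(* Let $k\ge1$ and let $A_i,B_{i1},\ldots,B_{ik}\in\mathbb{C}^{m_i\times n_i}$ with $m_i\ge n_i$ for $1\le i\le k$. Let $\varphi$ and $\varphi_i$ ($1\le i\le k$) be the infima defined in the context, and for each $i$ let $[A_i,B_{i1},\ldots,B_{ik}]=U^i\Sigma^i(V^i)^{H}$ be an SVD partitioned as in the context, with $\widetilde m_i=\min\{m_i,(k+1)n_i\}$. Then $$\varphi=\sum_{i=1}^k\varphi_i=\sum_{i=1}^k\ \sum_{j=n_i+1}^{\widetilde m_i}\sigma_j^2\big([A_i,B_{i1},\ldots,B_{ik}]\big).$$ If, in addition, $\|V^i_{11}\|_2<1$ for $i=1,\ldots,k$, then $\varphi$ is attained by $$\widehat A_i=U_1^i\Sigma_1^i(V_{11}^i)^{H},\qquad \widehat B_{is}=U_1^i\Sigma_1^i(V_{s+1\,1}^i)^{H}\quad(1\le s\le k),\qquad 1\le i\le k,$$ that is, there exist $X_{is}\in\mathbb{C}^{n_i\times n_i}$ ($1\le i,s\le k$) which together with these $\widehat A_i,\widehat B_{is}$ are feasible for the problem defining $\varphi$ and give objective value $\varphi$.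
   Context: Notation: $\|\cdot\|_F$ is the Frobenius norm, $\|\cdot\|_2$ the spectral norm, $\sigma_j(M)$ the $j$th largest singular value of $M$, $M^{H}$ the conjugate transpose, and $[M_0,\ldots,M_k]$ horizontal concatenation. Definition of $\varphi$: $$\varphi=\inf\ \sum_{i=1}^k\big\|[\widehat A_i-A_i,\widehat B_{i1}-B_{i1},\ldots,\widehat B_{ik}-B_{ik}]\big\|_F^2$$ over all $\widehat A_i,\widehat B_{is}\in\mathbb{C}^{m_i\times n_i}$ and $X_{is}\in\mathbb{C}^{n_i\times n_i}$ ($1\le i,s\le k$) subject to $\widehat A_i=\widehat B_{i1}X_{i1}+\cdots+\widehat B_{ik}X_{ik}$ and $\operatorname{rank}([\widehat A_i,\widehat B_{i1},\ldots,\widehat B_{ik}])\le n_i$ for $1\le i\le k$. Definition of $\varphi_i$: for each fixed $i$, $\varphi_i=\inf\big\|[\widehat A_i-A_i,\widehat B_{i1}-B_{i1},\ldots,\widehat B_{ik}-B_{ik}]\big\|_F^2$ over all $\widehat A_i,\widehat B_{i1},\ldots,\widehat B_{ik}\in\mathbb{C}^{m_i\times n_i}$ and $X_{i1},\ldots,X_{ik}\in\mathbb{C}^{n_i\times n_i}$ subject to the same two constraints for that $i$. SVD partition: $U^i=[U_1^i,U_2^i]\in\mathbb{C}^{m_i\times\widetilde m_i}$ has orthonormal columns, with $U_1^i\in\mathbb{C}^{m_i\times n_i}$; $V^i\in\mathbb{C}^{(k+1)n_i\times(k+1)n_i}$ is unitary; $\Sigma^i=\begin{bmatrix}\Sigma_1^i&0\\0&\Sigma_2^i\end{bmatrix}\in\mathbb{R}^{\widetilde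 m_i\times(k+1)n_i}$, where $\Sigma_1^i\in\mathbb{R}^{n_i\times n_i}$ is diagonal containing the $n_i$ largest singular values of $[A_i,B_{i1},\ldots,B_{ik}]$ and $\Sigma_2^i\in\mathbb{R}^{(\widetilde m_i-n_i)\times kn_i}$ carries the remaining singular values on its main diagonal and is zero elsewhere. $V^i$ is partitioned into $k+1$ block rows of $n_i$ rows each, and two block columns of $n_i$ and $kn_i$ columns: the blocks of the $r$th block row are $V^i_{r1}\in\mathbb{C}^{n_i\times n_i}$ and $V^i_{r2}\in\mathbb{C}^{n_i\times kn_i}$, $1\le r\le k+1$ (so $V^i_{s+1\,1}$ is the block with $r=s+1$ in the first block column). *)

theory Defs
  imports
    Complex_Main
    "HOL-Computational_Algebra.Fundamental_Theorem_Algebra"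
    "Jordan_Normal_Form.Schur_Decomposition"
    "Jordan_Normal_Form.DL_Rank"
begin

(* The row dimension m is explicit, so that concatenating no columns still
   gives an m x 0 matrix. *)
definition hcat :: "nat \<Rightarrow> complex mat list \<Rightarrow> complex mat" where
  "hcat m Ms = mat_of_cols m (concat (map cols Ms))"

(* [A, B 1, ..., B k], indexed from 1. *)
definition aug :: "nat \<Rightarrow> nat \<Rightarrow> complex mat \<Rightarrow> (nat \<Rightarrow> complex mat) \<Rightarrow> complex mat" where
  "aug k m A B = hcat m (A # map B [1..<Suc k])"

definition frobenius_norm :: "complex mat \<Rightarrow> real" where
  "frobenius_norm M = sqrt (\<Sum>a<dim_row M. \<Sum>b<dim_col M. (cmod (M $$ (a, b)))\<^sup>2)"

definition euclidean_norm :: "complex vec \<Rightarrow> real" where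
  "euclidean_norm v = sqrt (\<Sum>a<dim_vec v. (cmod (v $ a))\<^sup>2)"

definition spectral_norm :: "complex mat \<Rightarrow> real" where
  "spectral_norm M =
     Sup {euclidean_norm (M *\<^sub>v x) | x. x \<in> carrier_vec (dim_col M) \<and> euclidean_norm x \<le> 1}"

(* The j-th largest singular value, counted from j = 1 and with multiplicity:
   the square root of the j-th largest eigenvalue of M^H M.  Meaningful for
   1 <= j <= dim_col M; the values with j > dim_row M are zero. *)
definition singular_value :: "complex mat \<Rightarrow> nat \<Rightarrow> real" where
  "singular_value M j =
     rev (sorted_list_of_multiset
       (image_mset (\<lambda>z. sqrt (Re z)) (proots (char_poly (mat_adjoint M * M))))) ! (j - 1)"

definition mat_sum :: "nat \<Rightarrow> nat \<Rightarrow> ('i \<Rightarrow> complex mat) \<Rightarrow> 'i set \<Rightarrow> complex mat" where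
  "mat_sum m n F I = mat m n (\<lambda>(a, b). \<Sum>s\<in>I. F s $$ (a, b))"

definition feasible_block ::
  "nat \<Rightarrow> nat \<Rightarrow> nat \<Rightarrow> complex mat \<Rightarrow> (nat \<Rightarrow> complex mat) \<Rightarrow> (nat \<Rightarrow> complex mat) \<Rightarrow> bool" where
  "feasible_block k m n Ah Bh X \<longleftrightarrow>
     Ah \<in> carrier_mat m n \<and>
     (\<forall>s\<in>{1..k}. Bh s \<in> carrier_mat m n \<and> X s \<in> carrier_mat n n) \<and>
     Ah = mat_sum m n (\<lambda>s. Bh s * X s) {1..k} \<and>
     vec_space.rank m (aug k m Ah Bh) \<le> n"

definition cost_block ::
  "nat \<Rightarrow> nat \<Rightarrow> complex mat \<Rightarrow> (nat \<Rightarrow> complex mat) \<Rightarrow> complex mat \<Rightarrow> (nat \<Rightarrow> complex mat) \<Rightarrow> real" where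
  "cost_block k m A B Ah Bh = (frobenius_norm (aug k m (Ah - A) (\<lambda>s. Bh s - B s)))\<^sup>2"

definition phi_block ::
  "nat \<Rightarrow> nat \<Rightarrow> nat \<Rightarrow> complex mat \<Rightarrow> (nat \<Rightarrow> complex mat) \<Rightarrow> real" where
  "phi_block k m n A B = Inf {cost_block k m A B Ah Bh | Ah Bh X. feasible_block k m n Ah Bh X}"

definition feasible ::
  "nat \<Rightarrow> (nat \<Rightarrow> nat) \<Rightarrow> (nat \<Rightarrow> nat) \<Rightarrow> (nat \<Rightarrow> complex mat) \<Rightarrow>
   (nat \<Rightarrow> nat \<Rightarrow> complex mat) \<Rightarrow> (nat \<Rightarrow> nat \<Rightarrow> complex mat) \<Rightarrow> bool" where
  "feasible k m n Ah Bh X \<longleftrightarrow> (\<forall>i\<in>{1..k}. feasible_block k (m i) (n i) (Ah i) (Bh i) (X i))"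

definition cost ::
  "nat \<Rightarrow> (nat \<Rightarrow> nat) \<Rightarrow> (nat \<Rightarrow> complex mat) \<Rightarrow> (nat \<Rightarrow> nat \<Rightarrow> complex mat) \<Rightarrow>
   (nat \<Rightarrow> complex mat) \<Rightarrow> (nat \<Rightarrow> nat \<Rightarrow> complex mat) \<Rightarrow> real" where
  "cost k m A B Ah Bh = (\<Sum>i = 1..k. cost_block k (m i) (A i) (B i) (Ah i) (Bh i))"

definition phi ::
  "nat \<Rightarrow> (nat \<Rightarrow> nat) \<Rightarrow> (nat \<Rightarrow> nat) \<Rightarrow> (nat \<Rightarrow> complex mat) \<Rightarrow>
   (nat \<Rightarrow> nat \<Rightarrow> complex mat) \<Rightarrow> real" where
  "phi k m n A B = Inf {cost k m A B Ah Bh | Ah Bh X. feasible k m n Ah Bh X}"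

(* An SVD C = U S V^H with U = [U1, U2] and S = diag(S1, S2), where
   t = min m ((k+1) n) is the number of columns of U.  Only the split of the
   singular values between S1 and S2 is prescribed, not their order within S1
   or S2.  S1 and S2 have at least as many columns as rows, so diag_mat lists
   exactly the main diagonal. *)
definition partitioned_svd ::
  "nat \<Rightarrow> nat \<Rightarrow> nat \<Rightarrow> complex mat \<Rightarrow> complex mat \<Rightarrow> complex mat \<Rightarrow>
   real mat \<Rightarrow> real mat \<Rightarrow> complex mat \<Rightarrow> bool" where
  "partitioned_svd k m n C U1 U2 S1 S2 V \<longleftrightarrow>
     (let t = min m ((k + 1) * n);
          U = hcat m [U1, U2];
          S = four_block_mat S1 (0\<^sub>m n (k * n)) (0\<^sub>m (t - n) n) S2
      in U1 \<in> carrier_mat m n \<and> U2 \<in> carrier_mat m (t - n) \<and>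
         S1 \<in> carrier_mat n n \<and> S2 \<in> carrier_mat (t - n) (k * n) \<and>
         V \<in> carrier_mat ((k + 1) * n) ((k + 1) * n) \<and>
         mat_adjoint U * U = 1\<^sub>m t \<and>
         mat_adjoint V * V = 1\<^sub>m ((k + 1) * n) \<and>
         diagonal_mat S1 \<and> diagonal_mat S2 \<and>
         mset (diag_mat S1) = mset (map (singular_value C) [1..<Suc n]) \<and>
         mset (diag_mat S2) = mset (map (singular_value C) [Suc n..<Suc t]) \<and>
         C = U * map_mat complex_of_real S * mat_adjoint V)"

(* V_{r1}: the r-th block row (from r = 1, n rows each) of the first n columns. *)
definition V_block :: "nat \<Rightarrow> complex mat \<Rightarrow> nat \<Rightarrow> complex mat" where
  "V_block n V r = mat n n (\<lambda>(a, b). V $$ ((r - 1) * n + a, b))"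

end

theory Submission
  imports Defs
begin

text \<open>The blocks decouple, so fix one and write \<open>C = U \<Sigma> V\<^sup>H\<close> for \<open>[A, B\<^sub>1, \<dots>, B\<^sub>k]\<close>. A feasible point
  has rank at most \<open>n\<close>, so the Eckart--Young theorem bounds its cost below by the tail
  \<open>\<Sum>\<^bsub>j > n\<^esub> \<sigma>\<^sub>j\<^sup>2\<close>, which is the cost of the truncated SVD \<open>P [W\<^sub>1, \<dots>, W\<^sub>k\<^sub>+\<^sub>1]\<close>, where
  \<open>P = U\<^sub>1 \<Sigma>\<^sub>1\<close> and \<open>W\<^sub>r = V\<^sub>r\<^sub>1\<^sup>H\<close>. The truncation is feasible as soon as \<open>W\<^sub>1 = \<Sum>\<^sub>s W\<^sub>s\<^sub>+\<^sub>1 X\<^sub>s\<close> is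
  solvable. This can be forced by an arbitrarily small perturbation that makes \<open>W\<^sub>2\<close> invertible,
  whence the value of the infimum. If \<open>\<parallel>V\<^sub>1\<^sub>1\<parallel> < 1\<close> no perturbation is needed: the first block column
  of \<open>V\<close> is an isometry, so \<open>G = \<Sum>\<^sub>s W\<^sub>s\<^sub>+\<^sub>1 W\<^sub>s\<^sub>+\<^sub>1\<^sup>H\<close> is injective and
  \<open>X\<^sub>s = W\<^sub>s\<^sub>+\<^sub>1\<^sup>H G\<^sup>-\<^sup>1 W\<^sub>1\<close> works.\<close>

subsection \<open>Adjoints and the Frobenius norm\<close>

lemma mat_mult_index:
  assumes "A \<in> carrier_mat p q" "B \<in> carrier_mat q r" "i < p" "j < r"
  shows "(A * B) $$ (i, j) = (\<Sum>l<q. A $$ (i, l) * B $$ (l, j))"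
  using assms by (auto simp: scalar_prod_def atLeast0LessThan intro!: sum.cong)

lemma mat_adjoint_dim [simp]:
  "dim_row (mat_adjoint M) = dim_col M" "dim_col (mat_adjoint M) = dim_row M"
  by (simp_all add: mat_adjoint_def)

lemma mat_adjoint_carrier [simp, intro]:
  "M \<in> carrier_mat p q \<Longrightarrow> mat_adjoint M \<in> carrier_mat q p"
  by auto

lemma mat_adjoint_index [simp]:
  fixes M :: "complex mat"
  assumes "i < dim_col M" "j < dim_row M"
  shows "mat_adjoint M $$ (i, j) = cnj (M $$ (j, i))"
  using assms by (simp add: mat_adjoint_def mat_of_rows_index)

lemma mat_adjoint_adjoint [simp]:
  fixes M :: "complex mat"
  shows "mat_adjoint (mat_adjoint M) = M"
  by (rule eq_matI) auto

lemma mat_adjoint_mult: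
  fixes M :: "complex mat"
  assumes "M \<in> carrier_mat p q" "M' \<in> carrier_mat q r"
  shows "mat_adjoint (M * M') = mat_adjoint M' * mat_adjoint M"
proof (rule eq_matI)
  fix i j assume "i < dim_row (mat_adjoint M' * mat_adjoint M)" "j < dim_col (mat_adjoint M' * mat_adjoint M)"
  then have ij: "i < r" "j < p" using assms by auto
  have "mat_adjoint (M * M') $$ (i, j) = cnj ((M * M') $$ (j, i))"
    using assms ij by (intro mat_adjoint_index) auto
  also have "\<dots> = (\<Sum>l<q. mat_adjoint M' $$ (i, l) * mat_adjoint M $$ (l, j))"
    using assms ij by (subst mat_mult_index[OF assms]) (auto intro!: sum.cong)
  also have "\<dots> = (mat_adjoint M' * mat_adjoint M) $$ (i, j)"
    using assms ij by (subst mat_mult_index) auto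
  finally show "mat_adjoint (M * M') $$ (i, j) = (mat_adjoint M' * mat_adjoint M) $$ (i, j)" .
qed (use assms in auto)

lemma mat_adjoint_minus:
  fixes M :: "complex mat"
  assumes "M \<in> carrier_mat p q" "M' \<in> carrier_mat p q"
  shows "mat_adjoint (M - M') = mat_adjoint M - mat_adjoint M'"
  by (rule eq_matI) (use assms in auto)

text \<open>The objective is a sum of squared norms, so all computations are done without the square
  root.\<close>

definition frob_sq :: "complex mat \<Rightarrow> real" where
  "frob_sq M = (\<Sum>a<dim_row M. \<Sum>b<dim_col M. (cmod (M $$ (a, b)))\<^sup>2)"

lemma frob_sq_nonneg [simp]: "frob_sq M \<ge> 0"
  by (auto simp: frob_sq_def intro!: sum_nonneg)

lemma frobenius_norm_sq: "(frobenius_norm M)\<^sup>2 = frob_sq M"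
  using frob_sq_nonneg[of M] by (simp add: frobenius_norm_def frob_sq_def)

lemma frob_sq_adjoint [simp]: "frob_sq (mat_adjoint M) = frob_sq M"
  unfolding frob_sq_def by (subst sum.swap) simp

definition mat_trace :: "complex mat \<Rightarrow> complex" where
  "mat_trace M = (\<Sum>a<dim_row M. M $$ (a, a))"

lemma mat_trace_minus:
  "M \<in> carrier_mat p p \<Longrightarrow> M' \<in> carrier_mat p p \<Longrightarrow> mat_trace (M - M') = mat_trace M - mat_trace M'"
  by (auto simp: mat_trace_def sum_subtractf)

text \<open>The diagonal entries of M^H M are the squared norms of the columns of M. Norm identities
  thereby become identities between products of matrices.\<close>

lemma frob_sq_trace: "complex_of_real (frob_sq M) = mat_trace (mat_adjoint M * M)"
proof -
  have "(mat_adjoint M * M) $$ (b, b) = (\<Sum>a<dim_row M. complex_of_real ((cmod (M $$ (a, b)))\<^sup>2))"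
    if "b < dim_col M" for b
    using that
    by (subst mat_mult_index[of _ "dim_col M" "dim_row M" _ "dim_col M"])
      (auto simp: complex_norm_square[unfolded of_real_power] mult.commute intro!: sum.cong)
  then have "mat_trace (mat_adjoint M * M)
      = complex_of_real (\<Sum>b<dim_col M. \<Sum>a<dim_row M. (cmod (M $$ (a, b)))\<^sup>2)"
    by (simp add: mat_trace_def)
  then show ?thesis unfolding frob_sq_def by (subst sum.swap) simp
qed

lemma minus_mult_minus_mat:
  fixes A A' B B' :: "complex mat"
  assumes "A \<in> carrier_mat p q" "A' \<in> carrier_mat p q" "B \<in> carrier_mat q r" "B' \<in> carrier_mat q r"
  shows "(A - A') * (B - B') = A * B - A' * B - (A * B' - A' * B')"
  unfolding mult_minus_distrib_mat[OF minus_carrier_mat[OF assms(2)] assms(3,4)]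
    minus_mult_distrib_mat[OF assms(1,2,3)] minus_mult_distrib_mat[OF assms(1,2,4)] ..

text \<open>Completing the square: both sides expand to the same traces.\<close>

lemma frob_sq_diff_isometry:
  fixes C Q Y :: "complex mat"
  assumes C: "C \<in> carrier_mat m N" and Q: "Q \<in> carrier_mat m r" and Y: "Y \<in> carrier_mat r N"
    and iso: "mat_adjoint Q * Q = 1\<^sub>m r"
  shows "frob_sq (C - Q * Y) + frob_sq (mat_adjoint Q * C)
    = frob_sq C + frob_sq (mat_adjoint Q * C - Y)"
proof -
  let ?Z = "mat_adjoint Q * C"
  have Z: "?Z \<in> carrier_mat r N" using C Q by auto
  have Z': "mat_adjoint ?Z = mat_adjoint C * Q"
    using C Q by (subst mat_adjoint_mult[of _ r m _ N]) auto
  note car = C Q Y Z mat_adjoint_carrier[OF C] mat_adjoint_carrier[OF Q] mat_adjoint_carrier[OF Y]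
    mat_adjoint_carrier[OF Z] mult_carrier_mat[OF Q Y]
    mult_carrier_mat[OF mat_adjoint_carrier[OF Y] mat_adjoint_carrier[OF Q]]
    mult_carrier_mat[OF mat_adjoint_carrier[OF C] Q]
  have cross: "mat_adjoint C * (Q * Y) = mat_adjoint ?Z * Y"
    unfolding Z' by (rule assoc_mult_mat[symmetric]) (rule car)+
  have cross': "mat_adjoint Y * mat_adjoint Q * C = mat_adjoint Y * ?Z"
    by (rule assoc_mult_mat) (rule car)+
  have "mat_adjoint Y * mat_adjoint Q * (Q * Y) = mat_adjoint Y * (mat_adjoint Q * (Q * Y))"
    by (rule assoc_mult_mat) (rule car)+
  also have "mat_adjoint Q * (Q * Y) = Y"
    using iso car by (simp add: assoc_mult_mat[of "mat_adjoint Q" r m Q r Y N, symmetric])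
  finally have square: "mat_adjoint Y * mat_adjoint Q * (Q * Y) = mat_adjoint Y * Y" .
  have 1: "mat_adjoint (C - Q * Y) * (C - Q * Y)
     = mat_adjoint C * C - mat_adjoint Y * ?Z - (mat_adjoint ?Z * Y - mat_adjoint Y * Y)"
    unfolding mat_adjoint_minus[OF C mult_carrier_mat[OF Q Y]] mat_adjoint_mult[OF Q Y]
      minus_mult_minus_mat[OF car(5) car(10) C car(9)] cross cross' square ..
  have 2: "mat_adjoint (?Z - Y) * (?Z - Y)
     = mat_adjoint ?Z * ?Z - mat_adjoint Y * ?Z - (mat_adjoint ?Z * Y - mat_adjoint Y * Y)"
    unfolding mat_adjoint_minus[OF Z Y] minus_mult_minus_mat[OF car(8) car(7) Z Y] ..
  have sq: "mat_adjoint C * C \<in> carrier_mat N N" "mat_adjoint Y * ?Z \<in> carrier_mat N N"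
     "mat_adjoint ?Z * Y \<in> carrier_mat N N" "mat_adjoint Y * Y \<in> carrier_mat N N"
     "mat_adjoint ?Z * ?Z \<in> carrier_mat N N"
    by (rule mult_carrier_mat, rule car, rule car)+
  have tr: "mat_trace (X - Y1 - (Y2 - Y3)) = mat_trace X - mat_trace Y1 - (mat_trace Y2 - mat_trace Y3)"
    if "X \<in> carrier_mat N N" "Y1 \<in> carrier_mat N N" "Y2 \<in> carrier_mat N N" "Y3 \<in> carrier_mat N N"
    for X Y1 Y2 Y3
    using that by (simp add: mat_trace_minus[of _ N] minus_carrier_mat)
  have "complex_of_real (frob_sq (C - Q * Y) + frob_sq ?Z) = complex_of_real (frob_sq C + frob_sq (?Z - Y))"
    unfolding of_real_add frob_sq_trace 1 2 tr[OF sq(1-4)] tr[OF sq(5) sq(2-4)] by simp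
  then show ?thesis using of_real_eq_iff by blast
qed

text \<open>The isometry cancels in the Gram matrix of \<open>Q * M\<close>, leaving that of
  \<open>M\<close>, and the norm depends on the Gram matrix alone.\<close>

lemma frob_sq_isometry_mult:
  fixes Q M :: "complex mat"
  assumes Q: "Q \<in> carrier_mat m r" and M: "M \<in> carrier_mat r N"
    and iso: "mat_adjoint Q * Q = 1\<^sub>m r"
  shows "frob_sq (Q * M) = frob_sq M"
proof -
  have "mat_adjoint (Q * M) * (Q * M) = mat_adjoint M * (mat_adjoint Q * (Q * M))"
    using Q M by (simp add: mat_adjoint_mult[OF Q M]) (rule assoc_mult_mat, auto)
  also have "mat_adjoint Q * (Q * M) = M"
    using iso Q M by (simp add: assoc_mult_mat[of "mat_adjoint Q" r m Q r M N, symmetric])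
  finally have "complex_of_real (frob_sq (Q * M)) = complex_of_real (frob_sq M)"
    unfolding frob_sq_trace by simp
  then show ?thesis using of_real_eq_iff by blast
qed

text \<open>Taking adjoints moves the isometry to the left, where the previous lemma
  applies.\<close>

lemma frob_sq_mult_isometry_adjoint:
  fixes M V :: "complex mat"
  assumes M: "M \<in> carrier_mat m r" and V: "V \<in> carrier_mat N r"
    and iso: "mat_adjoint V * V = 1\<^sub>m r"
  shows "frob_sq (M * mat_adjoint V) = frob_sq M"
proof -
  have "frob_sq (M * mat_adjoint V) = frob_sq (V * mat_adjoint M)"
    using mat_adjoint_mult[OF M mat_adjoint_carrier[OF V]] frob_sq_adjoint[of "M * mat_adjoint V"] by simp
  also have "\<dots> = frob_sq M"
    using frob_sq_isometry_mult[OF V mat_adjoint_carrier[OF M] iso] by simp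
  finally show ?thesis .
qed

text \<open>With Y = Q^H C the last square in \<open>frob_sq_diff_isometry\<close> vanishes, and the
  difference of the two sides is the squared norm of C - Q Q^H C.\<close>

lemma frob_sq_adjoint_isometry_mult_le:
  fixes C Q :: "complex mat"
  assumes C: "C \<in> carrier_mat m N" and Q: "Q \<in> carrier_mat m r"
    and iso: "mat_adjoint Q * Q = 1\<^sub>m r"
  shows "frob_sq (mat_adjoint Q * C) \<le> frob_sq C"
proof -
  have Z: "mat_adjoint Q * C \<in> carrier_mat r N" using C Q by auto
  have "frob_sq (mat_adjoint Q * C - mat_adjoint Q * C) = 0"
    using Z by (simp add: frob_sq_def)
  then show ?thesis
    using frob_sq_diff_isometry[OF C Q Z iso] frob_sq_nonneg[of "C - Q * (mat_adjoint Q * C)"] by linarith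
qed

subsection \<open>Rank and singular values\<close>

text \<open>A column outside the span of \<open>S\<close> could be added to \<open>S\<close> without
  losing independence, against maximality.\<close>

lemma (in vec_space) cols_in_span_maximal:
  assumes D: "D \<in> carrier_mat n N"
    and S: "maximal S (\<lambda>T. T \<subseteq> set (cols D) \<and> lin_indpt T)"
  shows "set (cols D) \<subseteq> span S"
proof
  fix v assume v: "v \<in> set (cols D)"
  have D': "set (cols D) \<subseteq> carrier_vec n" using cols_dim[of D] D by auto
  have S': "S \<subseteq> set (cols D)" "lin_indpt S" using S by (auto simp: maximal_def)
  show "v \<in> span S"
  proof (cases "v \<in> S")
    case True
    then show ?thesis using in_own_span[of S] S' D' by auto
  next
    case False
    show ?thesis
    proof (rule ccontr)
      assume "v \<notin> span S"
      then have "lin_indpt (S \<union> {v})"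
        using lin_dep_iff_in_span[of S v] S' D' v False by auto
      then have "S \<union> {v} = S" using S S' v unfolding maximal_def by blast
      then show False using False by auto
    qed
  qed
qed

lemma (in vec_space) exists_maximal_indpt_cols:
  "\<exists>S. finite S \<and> maximal S (\<lambda>T. T \<subseteq> set (cols D) \<and> lin_indpt T)"
  using maximal_exists_superset[of "set (cols D)" "\<lambda>T. T \<subseteq> set (cols D) \<and> lin_indpt T" "{}"]
    finite_lin_indpt2[of "{}"] by auto

text \<open>The columns of \<open>P * M\<close> are combinations of the at most \<open>q\<close>
  columns of \<open>P\<close>, so no independent set among them is larger than
  \<open>q\<close>.\<close>

lemma (in vec_space) rank_mult_le:
  assumes P: "P \<in> carrier_mat n q" and M: "M \<in> carrier_mat q N"
  shows "rank (P * M) \<le> q"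
proof -
  obtain S where fin: "finite S"
    and S: "maximal S (\<lambda>T. T \<subseteq> set (cols (P * M)) \<and> lin_indpt T)"
    using exists_maximal_indpt_cols[of "P * M"] by auto
  have S': "S \<subseteq> set (cols (P * M))" "lin_indpt S" using S by (auto simp: maximal_def)
  have PM: "P * M \<in> carrier_mat n N" using P M by auto
  have "set (cols (P * M)) \<subseteq> col_space P"
  proof
    fix v assume "v \<in> set (cols (P * M))"
    then obtain j where j: "j < N" "v = col (P * M) j" using PM by (auto simp: cols_def)
    then have "v = P *\<^sub>v col M j" using col_mult2[OF P M j(1)] by simp
    then show "v \<in> col_space P" using P M j by (auto simp: col_space_eq[OF P])
  qed
  then have "S \<subseteq> span (set (cols P))" using S' by (auto simp: col_space_def)
  moreover have "set (cols P) \<subseteq> carrier_vec n" using cols_dim[of P] P by auto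
  \<comment> \<open>Steinitz exchange: the cardinality of the complementary set \<open>C\<close> is
    bounded by an integer difference, which must therefore be nonnegative.\<close>
  ultimately obtain C :: "'a vec set" where "int (card C) \<le> int (card (set (cols P))) - int (card S)"
    using replacement[of S "set (cols P)"] fin S' by auto
  then have "card S \<le> card (set (cols P))" by linarith
  also have "\<dots> \<le> q" using card_length[of "cols P"] P by simp
  finally show ?thesis using rank_card_indpt[OF PM S] by simp
qed

text \<open>Gram-Schmidt applied to a maximal independent set of columns yields an orthonormal basis
  of the column space; \<open>Y\<close> holds the coordinates. The Eckart-Young bound needs matrices
  of low rank in this form.\<close>

lemma rank_factorization_isometry:
  fixes D :: "complex mat"
  assumes D: "D \<in> carrier_mat m N"
  obtains Q Y where "Q \<in> carrier_mat m (vec_space.rank m D)" "Y \<in> carrier_mat (vec_space.rank m D) N"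
    "mat_adjoint Q * Q = 1\<^sub>m (vec_space.rank m D)" "D = Q * Y"
proof -
  interpret cof_vec_space m "TYPE(complex)" .
  define r where "r = rank D"
  obtain S where fin: "finite S"
    and S: "maximal S (\<lambda>T. T \<subseteq> set (cols D) \<and> lin_indpt T)"
    using exists_maximal_indpt_cols[of D] by auto
  have S': "S \<subseteq> set (cols D)" "lin_indpt S" using S by (auto simp: maximal_def)
  obtain ws where ws: "set ws = S" "distinct ws" using finite_distinct_list[OF fin] by auto
  have r: "length ws = r"
    using rank_card_indpt[OF D S] distinct_card[OF ws(2)] ws(1) by (simp add: r_def)
  define us where "us = gram_schmidt m ws"
  have ws': "set ws \<subseteq> carrier_vec m" using S' ws cols_dim[of D] D by auto
  note gs = gram_schmidt_result[OF ws' ws(2) _ us_def, unfolded ws(1), OF S'(2)]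
  have len: "length us = r" using gs(4) r by simp
  have us: "us ! i \<in> carrier_vec m" if "i < r" for i
    using gs(3) that len by (metis nth_mem subsetD)
  define W where "W = mat_of_cols m us"
  have W: "W \<in> carrier_mat m r" by (simp add: W_def len[symmetric])
  have cols_W: "cols W = us" unfolding W_def by (rule cols_mat_of_cols) (rule gs(3))
  have "\<exists>y\<in>carrier_vec r. W *\<^sub>v y = col D j" if "j < N" for j
  proof -
    have "col D j \<in> span S"
      using cols_in_span_maximal[OF D S] that D by (auto simp: cols_def)
    then have "col D j \<in> col_space W" unfolding col_space_def cols_W gs(1) .
    then show ?thesis using W by (auto simp: col_space_eq[OF W])
  qed
  then obtain y where y: "\<And>j. j < N \<Longrightarrow> y j \<in> carrier_vec r" "\<And>j. j < N \<Longrightarrow> W *\<^sub>v y j = col D j"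
    by metis
  \<comment> \<open>\<open>gram_schmidt\<close> orthogonalises without normalising. The length
    \<open>c i\<close> is divided out of the columns of \<open>Q\<close> and multiplied into the
    rows of \<open>Y\<close>, so the product is unchanged.\<close>
  define s where "s i = (\<Sum>a<m. (cmod (us ! i $ a))\<^sup>2)" for i
  define c where "c i = complex_of_real (sqrt (s i))" for i
  have ip: "us ! j \<bullet>c us ! i = (\<Sum>a<m. us ! j $ a * cnj (us ! i $ a))" if "i < r" for i j
    using us[OF that] by (auto simp: scalar_prod_def atLeast0LessThan intro!: sum.cong)
  have ip_self: "us ! i \<bullet>c us ! i = complex_of_real (s i)" if "i < r" for i
    unfolding ip[OF that] s_def by (simp add: complex_norm_square[unfolded of_real_power])
  have orth: "us ! j \<bullet>c us ! i = 0 \<longleftrightarrow> j \<noteq> i" if "i < r" "j < r" for i j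
    using corthogonalD[OF gs(2), of j i] that len by simp
  have s_pos: "s i > 0" if "i < r" for i
  proof -
    have "s i \<noteq> 0" using orth[OF that that] ip_self[OF that] by auto
    moreover have "s i \<ge> 0" by (auto simp: s_def intro!: sum_nonneg)
    ultimately show ?thesis by simp
  qed
  have c_nz: "c i \<noteq> 0" and c_cnj: "cnj (c i) = c i" and c_sq: "c i * c i = complex_of_real (s i)"
    if "i < r" for i
    using s_pos[OF that] by (simp_all add: c_def flip: of_real_mult)
  define Q where "Q = mat m r (\<lambda>(a, i). us ! i $ a / c i)"
  define Y where "Y = mat r N (\<lambda>(i, j). c i * y j $ i)"
  have Q: "Q \<in> carrier_mat m r" and Y: "Y \<in> carrier_mat r N" by (auto simp: Q_def Y_def)
  have "mat_adjoint Q * Q = 1\<^sub>m r"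
  proof (rule eq_matI)
    fix i j assume "i < dim_row (1\<^sub>m r)" "j < dim_col (1\<^sub>m r)"
    then have ij: "i < r" "j < r" by auto
    have "(mat_adjoint Q * Q) $$ (i, j) = (\<Sum>a<m. cnj (us ! i $ a / c i) * (us ! j $ a / c j))"
      using ij Q by (subst mat_mult_index[OF mat_adjoint_carrier[OF Q] Q]) (auto intro!: sum.cong simp: Q_def)
    \<comment> \<open>The indices are swapped because \<bullet>c conjugates its second
      argument.\<close>
    also have "\<dots> = (us ! j \<bullet>c us ! i) / (c i * c j)"
      unfolding ip[OF ij(1)] sum_divide_distrib by (simp add: c_cnj[OF ij(1)] field_simps)
    also have "\<dots> = (1\<^sub>m r) $$ (i, j)"
      using ij orth[OF ij] ip_self[OF ij(1)] c_sq[OF ij(1)] s_pos[OF ij(1)] by auto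
    finally show "(mat_adjoint Q * Q) $$ (i, j) = (1\<^sub>m r) $$ (i, j)" .
  qed (use Q in auto)
  moreover have "D = Q * Y"
  proof (rule eq_matI)
    fix a j assume "a < dim_row (Q * Y)" "j < dim_col (Q * Y)"
    then have aj: "a < m" "j < N" using Q Y by auto
    have "D $$ (a, j) = (W *\<^sub>v y j) $ a" using y(2)[OF aj(2)] aj D by simp
    also have "\<dots> = (\<Sum>i<r. us ! i $ a * y j $ i)"
      using aj W y(1)[OF aj(2)] len
      by (auto simp: scalar_prod_def atLeast0LessThan W_def mat_of_cols_index intro!: sum.cong)
    also have "\<dots> = (Q * Y) $$ (a, j)"
      using aj c_nz by (subst mat_mult_index[OF Q Y aj]) (auto simp: Q_def Y_def intro!: sum.cong)
    finally show "D $$ (a, j) = (Q * Y) $$ (a, j)" .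
  qed (use Q Y D in auto)
  ultimately show thesis using that Q Y unfolding r_def by blast
qed

text \<open>For an eigenvector v, the squared norm of C v equals z times that of v, and the latter
  is positive. The real part is the quantity that enters \<open>singular_value\<close>.\<close>

lemma eigenvalue_gram_nonneg:
  fixes C :: "complex mat"
  assumes C: "C \<in> carrier_mat m N" and z: "eigenvalue (mat_adjoint C * C) z"
  shows "Re z \<ge> 0"
proof -
  let ?G = "mat_adjoint C * C"
  have G: "?G \<in> carrier_mat N N" using C by auto
  obtain v where v: "v \<in> carrier_vec N" "v \<noteq> 0\<^sub>v N" "?G *\<^sub>v v = z \<cdot>\<^sub>v v"
    using z C unfolding eigenvalue_def eigenvector_def by auto
  \<comment> \<open>The vector is rewritten as a one-column matrix so that the trace formula applies
    to it.\<close>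
  define X where "X = mat N 1 (\<lambda>(a, _). v $ a)"
  have X: "X \<in> carrier_mat N 1" by (simp add: X_def)
  have GX: "?G * X = z \<cdot>\<^sub>m X"
  proof (rule eq_matI)
    fix i j assume "i < dim_row (z \<cdot>\<^sub>m X)" "j < dim_col (z \<cdot>\<^sub>m X)"
    then have ij: "i < N" "j < 1" using X by auto
    have "(?G * X) $$ (i, j) = (?G *\<^sub>v v) $ i"
      using ij G v(1) C
      by (subst mat_mult_index[OF G X ij])
        (auto simp: X_def scalar_prod_def atLeast0LessThan simp del: index_mult_mat intro!: sum.cong)
    then show "(?G * X) $$ (i, j) = (z \<cdot>\<^sub>m X) $$ (i, j)"
      using ij v by (simp add: X_def)
  qed (use C X in auto)
  have "mat_adjoint (C * X) * (C * X) = mat_adjoint X * mat_adjoint C * (C * X)"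
    by (simp add: mat_adjoint_mult[OF C X])
  also have "\<dots> = mat_adjoint X * (mat_adjoint C * (C * X))"
    by (rule assoc_mult_mat) (use C X in auto)
  also have "mat_adjoint C * (C * X) = z \<cdot>\<^sub>m X"
    using C X GX by (simp add: assoc_mult_mat[of "mat_adjoint C" N m C N X 1, symmetric])
  also have "mat_adjoint X * (z \<cdot>\<^sub>m X) = z \<cdot>\<^sub>m (mat_adjoint X * X)"
    by (rule mult_smult_distrib[of _ 1 N]) (use X in auto)
  finally have eq: "mat_adjoint (C * X) * (C * X) = z \<cdot>\<^sub>m (mat_adjoint X * X)" .
  have "complex_of_real (frob_sq (C * X)) = z * complex_of_real (frob_sq X)"
    unfolding frob_sq_trace eq using X by (simp add: mat_trace_def)
  from arg_cong[OF this, of Re] have "frob_sq (C * X) = Re z * frob_sq X" by simp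
  moreover have "frob_sq X > 0"
  proof -
    obtain a where a: "a < N" "v $ a \<noteq> 0"
      using v(1,2) by (metis carrier_vecD eq_vecI index_zero_vec)
    have "0 < (cmod (v $ a))\<^sup>2" using a by simp
    also have "\<dots> \<le> (\<Sum>i<N. (cmod (v $ i))\<^sup>2)"
      by (rule member_le_sum) (use a in auto)
    finally show ?thesis by (simp add: frob_sq_def X_def)
  qed
  ultimately show ?thesis
    using frob_sq_nonneg[of "C * X"] by (metis zero_le_mult_iff not_less)
qed

text \<open>A complex polynomial of degree N has N roots with multiplicity, so the ascending list
  \<open>L\<close> has length N and the j-th largest entry sits at position N - j. The bound
  \<open>j \<le> N\<close> keeps this position inside the list.\<close>

lemma singular_value_antimono:
  assumes C: "C \<in> carrier_mat m N" and ij: "1 \<le> i" "i \<le> j" "j \<le> N"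
  shows "0 \<le> singular_value C j" "singular_value C j \<le> singular_value C i"
proof -
  let ?G = "mat_adjoint C * C"
  define L where "L = sorted_list_of_multiset (image_mset (\<lambda>z. sqrt (Re z)) (proots (char_poly ?G)))"
  have G: "?G \<in> carrier_mat N N" using C by auto
  have cp: "degree (char_poly ?G) = N" "char_poly ?G \<noteq> 0" using degree_monic_char_poly[OF G] by auto
  have "mset L = image_mset (\<lambda>z. sqrt (Re z)) (proots (char_poly ?G))" by (simp add: L_def)
  from arg_cong[OF this, of size] arg_cong[OF this, of set_mset]
  have len: "length L = N" and setL: "set L = (\<lambda>z. sqrt (Re z)) ` {z. poly (char_poly ?G) z = 0}"
    using cp by (simp_all add: size_proots_complex)
  have nth: "singular_value C l = L ! (N - l)" if "1 \<le> l" "l \<le> N" for l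
    using that len by (simp add: singular_value_def L_def[symmetric] rev_nth)
  have "L ! (N - j) \<in> set L" using ij len by auto
  then show "0 \<le> singular_value C j"
    using nth[of j] ij eigenvalue_gram_nonneg[OF C] by (auto simp: setL eigenvalue_root_char_poly[OF G])
  have "sorted L" by (simp add: L_def)
  then have "L ! (N - j) \<le> L ! (N - i)" by (rule sorted_nth_mono) (use ij len in auto)
  then show "singular_value C j \<le> singular_value C i" using nth ij by simp
qed

subsection \<open>The Eckart--Young bound\<close>

text \<open>Neither sign nor order is imposed on the sequence \<open>s\<close>, so the same formulas
  cover an SVD and the error of its truncation, whose diagonal is partly zero and partly
  negated.\<close>

definition rect_diag :: "nat \<Rightarrow> nat \<Rightarrow> (nat \<Rightarrow> real) \<Rightarrow> complex mat" where
  "rect_diag t N s = mat t N (\<lambda>(l, b). if l = b then complex_of_real (s l) else 0)"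

lemma rect_diag_carrier [simp, intro]: "rect_diag t N s \<in> carrier_mat t N"
  by (simp add: rect_diag_def)

lemma mult_rect_diag_index:
  assumes "G \<in> carrier_mat r t" "t \<le> N" "a < r" "b < N"
  shows "(G * rect_diag t N s) $$ (a, b) = (if b < t then G $$ (a, b) * complex_of_real (s b) else 0)"
proof -
  have "(G * rect_diag t N s) $$ (a, b) = (\<Sum>l<t. G $$ (a, l) * rect_diag t N s $$ (l, b))"
    by (rule mat_mult_index[OF assms(1) rect_diag_carrier assms(3,4)])
  also have "\<dots> = (\<Sum>l<t. if l = b then G $$ (a, l) * complex_of_real (s l) else 0)"
    by (rule sum.cong) (use assms in \<open>auto simp: rect_diag_def\<close>)
  finally show ?thesis by simp
qed

text \<open>The columns of \<open>V\<close> from index \<open>t\<close> on meet zero columns of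
  \<open>rect_diag t N s\<close>, so only \<open>t\<close> rank-one terms remain.\<close>

lemma svd_index:
  assumes "U \<in> carrier_mat m t" "V \<in> carrier_mat N N" "t \<le> N" "a < m" "b < N"
  shows "(U * rect_diag t N s * mat_adjoint V) $$ (a, b)
    = (\<Sum>l<t. U $$ (a, l) * complex_of_real (s l) * cnj (V $$ (b, l)))"
proof -
  have "(U * rect_diag t N s * mat_adjoint V) $$ (a, b)
     = (\<Sum>l<N. (if l < t then U $$ (a, l) * complex_of_real (s l) else 0) * cnj (V $$ (b, l)))"
    using assms
    by (subst mat_mult_index[of _ m N _ N])
      (auto intro!: sum.cong simp: mult_rect_diag_index simp del: index_mult_mat(1))
  also have "\<dots> = (\<Sum>l<t. (if l < t then U $$ (a, l) * complex_of_real (s l) else 0) * cnj (V $$ (b, l)))"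
    by (rule sum.mono_neutral_right) (use assms(3) in auto)
  also have "\<dots> = (\<Sum>l<t. U $$ (a, l) * complex_of_real (s l) * cnj (V $$ (b, l)))"
    by (rule sum.cong) auto
  finally show ?thesis .
qed

text \<open>Each column of \<open>G\<close> is scaled by one \<open>s l\<close>; its squared norm
  becomes the weight of that term in the Eckart-Young estimate.\<close>

lemma frob_sq_mult_rect_diag:
  assumes G: "G \<in> carrier_mat r t" and t: "t \<le> N"
  shows "frob_sq (G * rect_diag t N s) = (\<Sum>l<t. (\<Sum>a<r. (cmod (G $$ (a, l)))\<^sup>2) * (s l)\<^sup>2)"
proof -
  have "frob_sq (G * rect_diag t N s)
      = (\<Sum>a<r. \<Sum>b<N. (cmod (if b < t then G $$ (a, b) * complex_of_real (s b) else 0))\<^sup>2)"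
    unfolding frob_sq_def using G t
    by (auto intro!: sum.cong simp: mult_rect_diag_index rect_diag_def[of t N s, THEN arg_cong, of dim_col]
        simp del: index_mult_mat(1))
  also have "\<dots> = (\<Sum>a<r. \<Sum>b<t. (cmod (if b < t then G $$ (a, b) * complex_of_real (s b) else 0))\<^sup>2)"
    by (intro sum.cong refl sum.mono_neutral_right) (use t in auto)
  also have "\<dots> = (\<Sum>a<r. \<Sum>b<t. (cmod (G $$ (a, b)))\<^sup>2 * (s b)\<^sup>2)"
    by (auto intro!: sum.cong simp: norm_mult power_mult_distrib)
  finally show ?thesis by (subst (asm) sum.swap) (simp add: sum_distrib_right)
qed

lemma frob_sq_rect_diag:
  assumes "t \<le> N"
  shows "frob_sq (rect_diag t N s) = (\<Sum>l<t. (s l)\<^sup>2)"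
proof -
  have "(\<Sum>a<t. (cmod ((1\<^sub>m t :: complex mat) $$ (a, l)))\<^sup>2) = 1" if "l < t" for l
  proof -
    have "(\<Sum>a<t. (cmod ((1\<^sub>m t :: complex mat) $$ (a, l)))\<^sup>2) = (\<Sum>a<t. if a = l then 1 else 0)"
      using that by (intro sum.cong) auto
    then show ?thesis using that by simp
  qed
  then show ?thesis
    using frob_sq_mult_rect_diag[OF one_carrier_mat assms, of s]
    by (simp add: left_mult_one_mat[OF rect_diag_carrier])
qed

lemma frob_sq_svd:
  fixes U V :: "complex mat"
  assumes U: "U \<in> carrier_mat m t" and V: "V \<in> carrier_mat N N" and t: "t \<le> N"
    and isoU: "mat_adjoint U * U = 1\<^sub>m t" and isoV: "mat_adjoint V * V = 1\<^sub>m N"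
  shows "frob_sq (U * rect_diag t N s * mat_adjoint V) = (\<Sum>l<t. (s l)\<^sup>2)"
  using frob_sq_mult_isometry_adjoint[OF _ V isoV, of "U * rect_diag t N s" m]
    frob_sq_isometry_mult[OF U rect_diag_carrier isoU, of N s] frob_sq_rect_diag[OF t, of s] U by auto

text \<open>With \<open>w\<^sub>l = \<parallel>Q\<^sup>H u\<^sub>l\<parallel>\<^sup>2\<close>, the squared norm of \<open>Q\<^sup>H C\<close> is \<open>\<Sum> w\<^sub>l s\<^sub>l\<^sup>2\<close>, and the weights satisfy
  \<open>w\<^sub>l \<le> 1\<close> and \<open>\<Sum> w\<^sub>l \<le> r \<le> n\<close>; so it is at most the sum of the \<open>n\<close> largest \<open>s\<^sub>l\<^sup>2\<close>.\<close>

lemma eckart_young_bound: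
  fixes U V Q Y :: "complex mat"
  assumes U: "U \<in> carrier_mat m t" and V: "V \<in> carrier_mat N N" and t: "t \<le> N"
    and isoU: "mat_adjoint U * U = 1\<^sub>m t" and isoV: "mat_adjoint V * V = 1\<^sub>m N"
    and Q: "Q \<in> carrier_mat m r" and Y: "Y \<in> carrier_mat r N" and isoQ: "mat_adjoint Q * Q = 1\<^sub>m r"
    and r: "r \<le> n" and n: "n \<le> t" and \<tau>: "\<tau> \<ge> 0"
    and large: "\<And>l. l < n \<Longrightarrow> \<tau> \<le> (s l)\<^sup>2"
    and small: "\<And>l. n \<le> l \<Longrightarrow> l < t \<Longrightarrow> (s l)\<^sup>2 \<le> \<tau>"
  shows "(\<Sum>l=n..<t. (s l)\<^sup>2) \<le> frob_sq (U * rect_diag t N s * mat_adjoint V - Q * Y)"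
proof -
  let ?T = "rect_diag t N s"
  define C where "C = U * ?T * mat_adjoint V"
  have C: "C \<in> carrier_mat m N" using U V by (auto simp: C_def)
  define G where "G = mat_adjoint Q * U"
  have G: "G \<in> carrier_mat r t" using Q U by (auto simp: G_def)
  define w where "w l = (\<Sum>a<r. (cmod (G $$ (a, l)))\<^sup>2)" for l
  have "mat_adjoint Q * C = mat_adjoint Q * (U * ?T) * mat_adjoint V"
    unfolding C_def by (rule assoc_mult_mat[of _ r m _ N _ N, symmetric]) (use Q U V in auto)
  also have "mat_adjoint Q * (U * ?T) = G * ?T"
    unfolding G_def by (rule assoc_mult_mat[of _ r m _ t _ N, symmetric]) (use Q U in auto)
  finally have "frob_sq (mat_adjoint Q * C) = frob_sq (G * ?T)"
    using frob_sq_mult_isometry_adjoint[OF _ V isoV, of "G * ?T" r] G by auto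
  then have QC: "frob_sq (mat_adjoint Q * C) = (\<Sum>l<t. w l * (s l)\<^sup>2)"
    using frob_sq_mult_rect_diag[OF G t] by (simp add: w_def)
  \<comment> \<open>Column l of \<open>G\<close> is \<open>G * ?E\<close> with \<open>?E\<close> the
    l-th unit column. Applying \<open>U\<close> keeps its norm at 1 and applying Q^H cannot increase
    it.\<close>
  have w_le: "w l \<le> 1" if l: "l < t" for l
  proof -
    let ?E = "mat t 1 (\<lambda>(i, _). if i = l then 1 else 0 :: complex)"
    have E: "?E \<in> carrier_mat t 1" by simp
    have "(G * ?E) $$ (a, 0) = G $$ (a, l)" if "a < r" for a
    proof -
      have "(G * ?E) $$ (a, 0) = (\<Sum>i<t. G $$ (a, i) * ?E $$ (i, 0))"
        by (rule mat_mult_index[OF G E that]) simp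
      also have "\<dots> = (\<Sum>i<t. if i = l then G $$ (a, i) else 0)"
        by (rule sum.cong) auto
      finally show ?thesis using l by simp
    qed
    then have "w l = frob_sq (G * ?E)" using G by (simp add: w_def frob_sq_def del: index_mult_mat(1))
    also have "G * ?E = mat_adjoint Q * (U * ?E)"
      unfolding G_def by (rule assoc_mult_mat[of _ r m _ t _ 1]) (use Q U in auto)
    also have "frob_sq \<dots> \<le> frob_sq (U * ?E)"
      by (rule frob_sq_adjoint_isometry_mult_le[OF _ Q isoQ]) (use U in auto)
    also have "\<dots> = frob_sq ?E" by (rule frob_sq_isometry_mult[OF U E isoU])
    also have "\<dots> = (\<Sum>i<t. (cmod (if i = l then 1 else 0))\<^sup>2)" by (simp add: frob_sq_def)
    also have "\<dots> = (\<Sum>i<t. if i = l then 1 else 0)" by (rule sum.cong) auto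
    finally show ?thesis using l by simp
  qed
  \<comment> \<open>The total weight is the squared norm of Q^H U. Its adjoint U^H Q is bounded by
    the norm of Q, whose square is the trace of the r x r identity.\<close>
  have "(\<Sum>l<t. w l) = frob_sq G"
    unfolding w_def frob_sq_def using G by (subst sum.swap) simp
  also have "\<dots> = frob_sq (mat_adjoint U * Q)"
    using frob_sq_adjoint[of G] mat_adjoint_mult[OF mat_adjoint_carrier[OF Q] U] by (simp add: G_def)
  also have "\<dots> \<le> frob_sq Q" by (rule frob_sq_adjoint_isometry_mult_le[OF Q U isoU])
  also have "frob_sq Q = real r"
  proof -
    have "complex_of_real (frob_sq Q) = complex_of_real (real r)"
      unfolding frob_sq_trace isoQ by (simp add: mat_trace_def)
    then show ?thesis by (simp only: of_real_eq_iff)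
  qed
  finally have w_sum: "(\<Sum>l<t. w l) \<le> real n" using r by simp
  have split: "(\<Sum>l<t. f l) = (\<Sum>l<n. f l) + (\<Sum>l=n..<t. f l)" for f :: "nat \<Rightarrow> real"
    using sum.atLeastLessThan_concat[of 0 n t f] n by (simp add: atLeast0LessThan)
  \<comment> \<open>The threshold \<tau> separates head from tail: 1 - w is nonnegative on the head
    and w on the tail, so each term compares with \<tau>. The left side is the tail plus \<tau>
    times the slack n - sum w; the right side is the squared norm of C minus that of Q^H C, a lower
    bound for the error by completing the square.\<close>
  have "(\<Sum>l<n. \<tau> * (1 - w l)) + (\<Sum>l=n..<t. (s l)\<^sup>2 - \<tau> * w l)
     \<le> (\<Sum>l<n. (s l)\<^sup>2 * (1 - w l)) + (\<Sum>l=n..<t. (s l)\<^sup>2 - (s l)\<^sup>2 * w l)"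
  proof (intro add_mono sum_mono)
    fix l assume "l \<in> {..<n}"
    then show "\<tau> * (1 - w l) \<le> (s l)\<^sup>2 * (1 - w l)"
      using n w_le[of l] large[of l] by (intro mult_right_mono) auto
  next
    fix l assume "l \<in> {n..<t}"
    then have "(s l)\<^sup>2 * w l \<le> \<tau> * w l"
      using small[of l] by (intro mult_right_mono) (auto simp: w_def intro!: sum_nonneg)
    then show "(s l)\<^sup>2 - \<tau> * w l \<le> (s l)\<^sup>2 - (s l)\<^sup>2 * w l" by simp
  qed
  moreover have "(\<Sum>l<n. \<tau> * (1 - w l)) + (\<Sum>l=n..<t. (s l)\<^sup>2 - \<tau> * w l)
      = \<tau> * (real n - (\<Sum>l<t. w l)) + (\<Sum>l=n..<t. (s l)\<^sup>2)"
    unfolding split[of w] by (simp add: sum_subtractf sum_distrib_left[symmetric] algebra_simps)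
  moreover have "\<tau> * (real n - (\<Sum>l<t. w l)) \<ge> 0" using \<tau> w_sum by auto
  moreover have "(\<Sum>l<n. (s l)\<^sup>2 * (1 - w l)) + (\<Sum>l=n..<t. (s l)\<^sup>2 - (s l)\<^sup>2 * w l)
      = (\<Sum>l<t. (s l)\<^sup>2) - (\<Sum>l<t. w l * (s l)\<^sup>2)"
    unfolding split[of "\<lambda>l. (s l)\<^sup>2"] split[of "\<lambda>l. w l * (s l)\<^sup>2"]
    by (simp add: sum_subtractf algebra_simps)
  moreover have "frob_sq C = (\<Sum>l<t. (s l)\<^sup>2)"
    unfolding C_def by (rule frob_sq_svd[OF U V t isoU isoV])
  ultimately show ?thesis
    using frob_sq_diff_isometry[OF C Q Y isoQ] QC frob_sq_nonneg[of "mat_adjoint Q * C - Y"]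
    unfolding C_def[symmetric] by linarith
qed

subsection \<open>The partitioned SVD\<close>

lemma hcat_pair:
  assumes "U1 \<in> carrier_mat m n" "U2 \<in> carrier_mat m q"
  shows "hcat m [U1, U2] \<in> carrier_mat m (n + q)"
    and "a < m \<Longrightarrow> l < n \<Longrightarrow> hcat m [U1, U2] $$ (a, l) = U1 $$ (a, l)"
  using assms by (auto simp: hcat_def mat_of_cols_index nth_append)

text \<open>The SVD fixes the diagonals of \<open>S1\<close> and \<open>S2\<close> only as
  multisets. The threshold \<tau> captures what the Eckart-Young bound needs: every head value
  dominates every tail value, in whatever order they are listed.\<close>

lemma partitioned_svd_rect_diag:
  assumes svd: "partitioned_svd k m n C U1 U2 S1 S2 V" and nm: "n \<le> m"
    and C: "C \<in> carrier_mat m ((k + 1) * n)"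
  defines "t \<equiv> min m ((k + 1) * n)"
  obtains U s \<tau> where
    "U \<in> carrier_mat m t" "mat_adjoint U * U = 1\<^sub>m t"
    "C = U * rect_diag t ((k + 1) * n) s * mat_adjoint V"
    "\<And>a l. a < m \<Longrightarrow> l < n \<Longrightarrow> U $$ (a, l) = U1 $$ (a, l)"
    "\<And>a l. a < n \<Longrightarrow> l < n \<Longrightarrow> S1 $$ (a, l) = (if a = l then s l else 0)"
    "\<tau> \<ge> 0" "\<And>l. l < n \<Longrightarrow> \<tau> \<le> (s l)\<^sup>2" "\<And>l. n \<le> l \<Longrightarrow> l < t \<Longrightarrow> (s l)\<^sup>2 \<le> \<tau>"
    "(\<Sum>l=n..<t. (s l)\<^sup>2) = (\<Sum>j=n+1..t. (singular_value C j)\<^sup>2)"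
proof -
  let ?N = "(k + 1) * n"
  have nt: "n \<le> t" "t \<le> ?N" using nm by (auto simp: t_def)
  define U where "U = hcat m [U1, U2]"
  define S where "S = four_block_mat S1 (0\<^sub>m n (k * n)) (0\<^sub>m (t - n) n) S2"
  note svd' = svd[unfolded partitioned_svd_def Let_def, folded t_def, folded U_def S_def]
  have U1: "U1 \<in> carrier_mat m n" and U2: "U2 \<in> carrier_mat m (t - n)"
    and S1: "S1 \<in> carrier_mat n n" and S2: "S2 \<in> carrier_mat (t - n) (k * n)"
    and isoU: "mat_adjoint U * U = 1\<^sub>m t"
    and diag: "diagonal_mat S1" "diagonal_mat S2"
    and ms1: "mset (diag_mat S1) = mset (map (singular_value C) [1..<Suc n])"
    and ms2: "mset (diag_mat S2) = mset (map (singular_value C) [Suc n..<Suc t])"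
    and C_eq: "C = U * map_mat complex_of_real S * mat_adjoint V"
    using svd' by blast+
  have U: "U \<in> carrier_mat m t" using hcat_pair(1)[OF U1 U2] nt by (simp add: U_def)
  define s where "s l = (if l < n then S1 $$ (l, l) else S2 $$ (l - n, l - n))" for l
  have "map_mat complex_of_real S = rect_diag t ?N s"
  proof (rule eq_matI)
    fix l b assume "l < dim_row (rect_diag t ?N s)" "b < dim_col (rect_diag t ?N s)"
    then have "l < t" "b < n + k * n" by (auto simp: rect_diag_def)
    then show "map_mat complex_of_real S $$ (l, b) = rect_diag t ?N s $$ (l, b)"
      using S1 S2 diag nt
      by (auto simp: S_def rect_diag_def s_def diagonal_mat_def)
  qed (use S1 S2 nt in \<open>auto simp: S_def rect_diag_def\<close>)
  then have C_eq': "C = U * rect_diag t ?N s * mat_adjoint V" using C_eq by simp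
  have S1_index: "S1 $$ (a, l) = (if a = l then s l else 0)" if "a < n" "l < n" for a l
    using that S1 diag by (auto simp: s_def diagonal_mat_def)
  have d1: "diag_mat S1 = map s [0..<n]"
    using S1 by (auto simp: diag_mat_def s_def)
  have d2: "diag_mat S2 = map (\<lambda>l. s (n + l)) [0..<t - n]"
    using S2 by (auto simp: diag_mat_def s_def)
  \<comment> \<open>For comparisons with \<tau> the sets of values suffice; the sum of squares at
    the end goes back to the multisets, since multiplicities count there.\<close>
  have set1: "s ` {..<n} = singular_value C ` {1..n}"
    using arg_cong[OF ms1, of set_mset] unfolding d1 by (simp add: atLeast0LessThan atLeastLessThanSuc_atLeastAtMost del: upt_Suc)
  have set2: "(\<lambda>l. s (n + l)) ` {..<t - n} = singular_value C ` {n+1..t}"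
    using arg_cong[OF ms2, of set_mset] unfolding d2 by (simp add: atLeast0LessThan atLeastLessThanSuc_atLeastAtMost del: upt_Suc)
  \<comment> \<open>The largest tail value squared, or 0 if the tail is empty.\<close>
  define \<tau> where "\<tau> = (if n < t then (singular_value C (n + 1))\<^sup>2 else 0)"
  have large: "\<tau> \<le> (s l)\<^sup>2" if "l < n" for l
  proof -
    have "s l \<in> singular_value C ` {1..n}" unfolding set1[symmetric] using that by blast
    then obtain j where "1 \<le> j" "j \<le> n" "s l = singular_value C j" by auto
    then show ?thesis
      using singular_value_antimono[OF C, of j "n + 1"] order.trans[of "n + 1" t ?N] nt
      by (cases "n < t") (simp_all add: \<tau>_def power_mono)
  qed
  have small: "(s l)\<^sup>2 \<le> \<tau>" if "n \<le> l" "l < t" for l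
  proof -
    have "s l \<in> (\<lambda>l. s (n + l)) ` {..<t - n}"
      by (rule image_eqI[of _ _ "l - n"]) (use that in auto)
    then obtain j where "n + 1 \<le> j" "j \<le> t" "s l = singular_value C j"
      unfolding set2 by auto
    then show ?thesis
      using singular_value_antimono[OF C, of "n + 1" j] nt that by (simp add: \<tau>_def power_mono)
  qed
  have sum_map: "sum_mset (image_mset power2 (mset (map f [a..<b]))) = (\<Sum>l=a..<b. (f l)\<^sup>2)"
    for f :: "nat \<Rightarrow> real" and a b
    by (simp only: mset_map[symmetric] sum_mset_sum_list map_map comp_def
        interv_sum_list_conv_sum_set_nat set_upt)
  have "(\<Sum>l=n..<t. (s l)\<^sup>2) = (\<Sum>l<t - n. (s (n + l))\<^sup>2)"
    using sum.shift_bounds_nat_ivl[of "\<lambda>l. (s l)\<^sup>2" 0 n "t - n"] nt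
    by (simp add: atLeast0LessThan add.commute)
  also have "\<dots> = sum_mset (image_mset power2 (mset (diag_mat S2)))"
    unfolding d2 sum_map by (simp add: atLeast0LessThan)
  also have "\<dots> = (\<Sum>j=n+1..t. (singular_value C j)\<^sup>2)"
    unfolding ms2 sum_map by (simp add: atLeastLessThanSuc_atLeastAtMost)
  finally have "(\<Sum>l=n..<t. (s l)\<^sup>2) = (\<Sum>j=n+1..t. (singular_value C j)\<^sup>2)" .
  moreover have "\<tau> \<ge> 0" by (simp add: \<tau>_def)
  ultimately show thesis
    using that[OF U isoU C_eq' _ S1_index] large small hcat_pair(2)[OF U1 U2] unfolding U_def by blast
qed

subsection \<open>Block matrices\<close>

lemma concat_nth_uniform:
  assumes "\<And>xs. xs \<in> set xss \<Longrightarrow> length xs = n"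
  shows "length (concat xss) = length xss * n"
    and "i < length xss \<Longrightarrow> j < n \<Longrightarrow> concat xss ! (i * n + j) = xss ! i ! j"
  using assms
proof (induction xss arbitrary: i)
  case (Cons xs xss)
  {
    case 1
    then show ?case using Cons.IH(1) by simp
  next
    case 2
    then show ?case using Cons.IH(2)[of "i - 1"] by (cases i) (auto simp: nth_append)
  }
qed simp_all

lemma aug_carrier:
  assumes "A \<in> carrier_mat m n" "\<And>s. s \<in> {1..k} \<Longrightarrow> B s \<in> carrier_mat m n"
  shows "aug k m A B \<in> carrier_mat m ((k + 1) * n)"
proof -
  have "length (concat (map cols (A # map B [1..<Suc k]))) = (k + 1) * n"
    using assms(1) carrier_matD(2)[OF assms(2)] by (subst concat_nth_uniform(1)[of _ n]) auto
  then show ?thesis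
    using mat_of_cols_carrier(1)[of m "concat (map cols (A # map B [1..<Suc k]))"]
    by (simp only: aug_def hcat_def)
qed

lemma aug_index:
  assumes "A \<in> carrier_mat m n" "\<And>s. s \<in> {1..k} \<Longrightarrow> B s \<in> carrier_mat m n"
    and "a < m" "b < (k + 1) * n"
  shows "aug k m A B $$ (a, b) = (if b div n = 0 then A else B (b div n)) $$ (a, b mod n)"
proof -
  define Ms where "Ms = A # map B [1..<Suc k]"
  define r where "r = b div n"
  \<comment> \<open>The bound on \<open>b\<close> rules out n = 0, so division by \<open>n\<close>
    splits \<open>b\<close> into a block number and a column within the block.\<close>
  have n: "n > 0" using assms(4) by (cases n) auto
  have r: "r < k + 1" "b = r * n + b mod n" using assms(4) n by (simp_all add: r_def less_mult_imp_div_less)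
  have cols: "length c = n" if "c \<in> set (map cols Ms)" for c
    using that assms(1) carrier_matD(2)[OF assms(2)] by (auto simp: Ms_def)
  have len: "length Ms = k + 1" by (simp add: Ms_def)
  have len_concat: "length (concat (map cols Ms)) = (k + 1) * n"
    by (subst concat_nth_uniform(1)[of _ n]) (erule cols, simp add: len)
  have Ms_r: "Ms ! r = (if r = 0 then A else B r)"
    using r(1) by (cases r) (auto simp: Ms_def nth_Cons' simp del: upt_Suc)
  have car: "Ms ! r \<in> carrier_mat m n" unfolding Ms_r using assms(1,2) r(1) by auto
  have "aug k m A B $$ (a, b) = concat (map cols Ms) ! b $ a"
    unfolding aug_def hcat_def Ms_def[symmetric] using assms(3,4) len_concat
    by (intro mat_of_cols_index) simp_all
  also have "concat (map cols Ms) ! b = map cols Ms ! r ! (b mod n)"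
    by (subst r(2), rule concat_nth_uniform(2)[OF cols]) (use r len n in auto)
  also have "\<dots> $ a = (Ms ! r) $$ (a, b mod n)"
    using car n assms(3) r(1) len by (simp add: cols_nth)
  finally show ?thesis unfolding Ms_r by (simp add: r_def)
qed

lemma aug_minus:
  assumes "A \<in> carrier_mat m n" "\<And>s. s \<in> {1..k} \<Longrightarrow> B s \<in> carrier_mat m n"
    and "A' \<in> carrier_mat m n" "\<And>s. s \<in> {1..k} \<Longrightarrow> B' s \<in> carrier_mat m n"
  shows "aug k m (A' - A) (\<lambda>s. B' s - B s) = aug k m A' B' - aug k m A B"
proof (rule eq_matI)
  note car = aug_carrier[of A m n k B, OF assms(1,2)] aug_carrier[of A' m n k B', OF assms(3,4)]
  have diff: "A' - A \<in> carrier_mat m n" "\<And>s. s \<in> {1..k} \<Longrightarrow> B' s - B s \<in> carrier_mat m n"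
    using assms by (auto intro!: minus_carrier_mat)
  show "dim_row (aug k m (A' - A) (\<lambda>s. B' s - B s)) = dim_row (aug k m A' B' - aug k m A B)"
    "dim_col (aug k m (A' - A) (\<lambda>s. B' s - B s)) = dim_col (aug k m A' B' - aug k m A B)"
    using car aug_carrier[of "A' - A" m n k "\<lambda>s. B' s - B s", OF diff] by auto
  fix a b assume "a < dim_row (aug k m A' B' - aug k m A B)" "b < dim_col (aug k m A' B' - aug k m A B)"
  then have ab: "a < m" "b < (k + 1) * n" using car by auto
  then have n: "n > 0" by (cases n) auto
  have r: "b div n \<le> k" using ab n less_mult_imp_div_less[of b "k + 1" n] by simp
  have "aug k m (A' - A) (\<lambda>s. B' s - B s) $$ (a, b)
      = (if b div n = 0 then A' - A else B' (b div n) - B (b div n)) $$ (a, b mod n)"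
    using aug_index[of "A' - A" m n k "\<lambda>s. B' s - B s", OF diff ab] by simp
  also have "\<dots> = aug k m A' B' $$ (a, b) - aug k m A B $$ (a, b)"
    using aug_index[of A m n k B, OF assms(1,2) ab] aug_index[of A' m n k B', OF assms(3,4) ab]
      assms(1) assms(2)[of "b div n"] ab(1) n r by (auto simp: Suc_le_eq)
  finally show "aug k m (A' - A) (\<lambda>s. B' s - B s) $$ (a, b) = (aug k m A' B' - aug k m A B) $$ (a, b)"
    using car ab by simp
qed

text \<open>Left multiplication acts column by column. Exposing the common factor is what bounds the
  rank of the concatenation.\<close>

lemma aug_mult_left:
  assumes P: "P \<in> carrier_mat m q" and W0: "W0 \<in> carrier_mat q n"
    and W: "\<And>s. s \<in> {1..k} \<Longrightarrow> W s \<in> carrier_mat q n"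
  shows "aug k m (P * W0) (\<lambda>s. P * W s) = P * aug k q W0 W"
proof (rule eq_matI)
  have PW: "P * W0 \<in> carrier_mat m n" "\<And>s. s \<in> {1..k} \<Longrightarrow> P * W s \<in> carrier_mat m n"
    using P W0 W by (auto intro!: mult_carrier_mat)
  note car = aug_carrier[of W0 q n k W, OF W0 W] aug_carrier[of "P * W0" m n k "\<lambda>s. P * W s", OF PW]
  show "dim_row (aug k m (P * W0) (\<lambda>s. P * W s)) = dim_row (P * aug k q W0 W)"
    "dim_col (aug k m (P * W0) (\<lambda>s. P * W s)) = dim_col (P * aug k q W0 W)"
    using car P by auto
  fix a b assume "a < dim_row (P * aug k q W0 W)" "b < dim_col (P * aug k q W0 W)"
  then have ab: "a < m" "b < (k + 1) * n" using car P by auto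
  then have n: "n > 0" by (cases n) auto
  have r: "b div n \<le> k" using ab n less_mult_imp_div_less[of b "k + 1" n] by simp
  define Wr where "Wr = (if b div n = 0 then W0 else W (b div n))"
  have Wr: "Wr \<in> carrier_mat q n" using W0 W r by (auto simp: Wr_def)
  have "aug k m (P * W0) (\<lambda>s. P * W s) $$ (a, b) = (P * Wr) $$ (a, b mod n)"
    using aug_index[of "P * W0" m n k "\<lambda>s. P * W s", OF PW ab] by (simp add: Wr_def)
  also have "\<dots> = (\<Sum>l<q. P $$ (a, l) * Wr $$ (l, b mod n))"
    using n by (intro mat_mult_index[OF P Wr ab(1)]) simp
  also have "\<dots> = (\<Sum>l<q. P $$ (a, l) * aug k q W0 W $$ (l, b))"
    using aug_index[of W0 q n k W, OF W0 W _ ab(2)] by (simp add: Wr_def)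
  also have "\<dots> = (P * aug k q W0 W) $$ (a, b)"
    by (rule mat_mult_index[OF P car(1) ab, symmetric])
  finally show "aug k m (P * W0) (\<lambda>s. P * W s) $$ (a, b) = (P * aug k q W0 W) $$ (a, b)" .
qed

lemma mat_sum_carrier [simp, intro]: "mat_sum m n F I \<in> carrier_mat m n"
  by (simp add: mat_sum_def)

lemma mat_sum_cong:
  "(\<And>s. s \<in> I \<Longrightarrow> F s = F' s) \<Longrightarrow> mat_sum m n F I = mat_sum m n F' I"
  by (simp add: mat_sum_def)

lemma mat_sum_mult_left:
  assumes P: "P \<in> carrier_mat p q" and F: "\<And>s. s \<in> I \<Longrightarrow> F s \<in> carrier_mat q r"
  shows "mat_sum p r (\<lambda>s. P * F s) I = P * mat_sum q r F I"
proof (rule eq_matI)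
  fix a b assume "a < dim_row (P * mat_sum q r F I)" "b < dim_col (P * mat_sum q r F I)"
  then have ab: "a < p" "b < r" using P by (auto simp: mat_sum_def)
  have "mat_sum p r (\<lambda>s. P * F s) I $$ (a, b) = (\<Sum>s\<in>I. (P * F s) $$ (a, b))"
    using ab by (simp add: mat_sum_def del: index_mult_mat(1))
  also have "\<dots> = (\<Sum>s\<in>I. \<Sum>l<q. P $$ (a, l) * F s $$ (l, b))"
    by (rule sum.cong[OF refl], rule mat_mult_index[OF P F ab])
  also have "\<dots> = (\<Sum>l<q. P $$ (a, l) * mat_sum q r F I $$ (l, b))"
    using ab by (subst sum.swap) (simp add: mat_sum_def sum_distrib_left)
  also have "\<dots> = (P * mat_sum q r F I) $$ (a, b)"
    by (rule mat_mult_index[OF P mat_sum_carrier ab, symmetric])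
  finally show "mat_sum p r (\<lambda>s. P * F s) I $$ (a, b) = (P * mat_sum q r F I) $$ (a, b)" .
qed (use P in \<open>auto simp: mat_sum_def\<close>)

lemma mat_sum_mult_right:
  assumes R: "R \<in> carrier_mat q r" and F: "\<And>s. s \<in> I \<Longrightarrow> F s \<in> carrier_mat p q"
  shows "mat_sum p r (\<lambda>s. F s * R) I = mat_sum p q F I * R"
proof (rule eq_matI)
  fix a b assume "a < dim_row (mat_sum p q F I * R)" "b < dim_col (mat_sum p q F I * R)"
  then have ab: "a < p" "b < r" using R by (auto simp: mat_sum_def)
  have "mat_sum p r (\<lambda>s. F s * R) I $$ (a, b) = (\<Sum>s\<in>I. (F s * R) $$ (a, b))"
    using ab by (simp add: mat_sum_def del: index_mult_mat(1))
  also have "\<dots> = (\<Sum>s\<in>I. \<Sum>l<q. F s $$ (a, l) * R $$ (l, b))"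
    by (rule sum.cong[OF refl], rule mat_mult_index[OF F R ab])
  also have "\<dots> = (\<Sum>l<q. mat_sum p q F I $$ (a, l) * R $$ (l, b))"
    using ab by (subst sum.swap) (simp add: mat_sum_def sum_distrib_right)
  also have "\<dots> = (mat_sum p q F I * R) $$ (a, b)"
    by (rule mat_mult_index[OF mat_sum_carrier R ab, symmetric])
  finally show "mat_sum p r (\<lambda>s. F s * R) I $$ (a, b) = (mat_sum p q F I * R) $$ (a, b)" .
qed (use R in \<open>auto simp: mat_sum_def\<close>)

text \<open>Feasibility reduces to a linear relation between n x n factors: multiplying it by
  \<open>P\<close> gives the equality constraint, and the \<open>n\<close> columns of
  \<open>P\<close> give the rank constraint.\<close>

lemma feasible_block_mult_left:
  assumes P: "P \<in> carrier_mat m n"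
    and W: "\<And>s. s \<in> {1..k} \<Longrightarrow> W s \<in> carrier_mat n n" and X: "\<And>s. s \<in> {1..k} \<Longrightarrow> X s \<in> carrier_mat n n"
    and W0: "W0 = mat_sum n n (\<lambda>s. W s * X s) {1..k}"
  shows "feasible_block k m n (P * W0) (\<lambda>s. P * W s) X"
proof -
  have W0': "W0 \<in> carrier_mat n n" by (simp add: W0)
  have "P * W0 = mat_sum m n (\<lambda>s. P * (W s * X s)) {1..k}"
    unfolding W0 by (rule mat_sum_mult_left[OF P, symmetric]) (use W X in \<open>auto intro!: mult_carrier_mat\<close>)
  also have "\<dots> = mat_sum m n (\<lambda>s. P * W s * X s) {1..k}"
    by (rule mat_sum_cong, rule assoc_mult_mat[OF P W X, symmetric])
  finally have "P * W0 = mat_sum m n (\<lambda>s. P * W s * X s) {1..k}" .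
  moreover have "vec_space.rank m (aug k m (P * W0) (\<lambda>s. P * W s)) \<le> n"
  proof -
    have "aug k m (P * W0) (\<lambda>s. P * W s) = P * aug k n W0 W"
      by (rule aug_mult_left[OF P W0']) (rule W)
    moreover have "aug k n W0 W \<in> carrier_mat n ((k + 1) * n)"
      by (rule aug_carrier[OF W0']) (rule W)
    ultimately show ?thesis using vec_space.rank_mult_le[OF P] by simp
  qed
  moreover have "P * W0 \<in> carrier_mat m n" "\<And>s. s \<in> {1..k} \<Longrightarrow> P * W s \<in> carrier_mat m n"
    using P W0' W by (auto intro!: mult_carrier_mat)
  ultimately show ?thesis unfolding feasible_block_def using X by blast
qed

section \<open>Invertible matrices and small perturbations\<close>

lemma det_nonzero_right_inverse:
  fixes M :: "complex mat"
  assumes M: "M \<in> carrier_mat n n" and "det M \<noteq> 0"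
  obtains R where "R \<in> carrier_mat n n" "M * R = 1\<^sub>m n"
proof -
  let ?R = "(1 / det M) \<cdot>\<^sub>m adj_mat M"
  have R: "?R \<in> carrier_mat n n" using adj_mat(1)[OF M] by simp
  have "M * ?R = (1 / det M) \<cdot>\<^sub>m (M * adj_mat M)"
    by (rule mult_smult_distrib[OF M adj_mat(1)[OF M]])
  also have "\<dots> = 1\<^sub>m n"
    unfolding adj_mat(2)[OF M] using assms(2) by (intro eq_matI) auto
  finally show thesis using that R by blast
qed

text \<open>The determinant vanishes only if -\<epsilon> is an eigenvalue of \<open>M\<close>. The
  characteristic polynomial has finitely many roots, whereas the interval from 0 to d is
  infinite.\<close>

lemma det_add_smult_one_nonzero:
  fixes M :: "complex mat" and d :: real
  assumes M: "M \<in> carrier_mat n n" and d: "d > 0"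
  obtains \<epsilon> :: real where "0 < \<epsilon>" "\<epsilon> < d" "det (M + complex_of_real \<epsilon> \<cdot>\<^sub>m 1\<^sub>m n) \<noteq> 0"
proof -
  have "char_poly M \<noteq> 0" using degree_monic_char_poly[OF M] by auto
  then have "finite {z. poly (char_poly M) z = 0}" by (rule poly_roots_finite)
  moreover have "inj_on (\<lambda>\<epsilon>. - complex_of_real \<epsilon>) {0<..<d}" by (rule inj_onI) simp
  then have "infinite ((\<lambda>\<epsilon>. - complex_of_real \<epsilon>) ` {0<..<d})"
    using d infinite_Ioo[of 0 d] finite_imageD by blast
  ultimately have "\<not> (\<lambda>\<epsilon>. - complex_of_real \<epsilon>) ` {0<..<d} \<subseteq> {z. poly (char_poly M) z = 0}"
    using finite_subset by blast
  then obtain \<epsilon> where "\<epsilon> \<in> {0<..<d}" "poly (char_poly M) (- complex_of_real \<epsilon>) \<noteq> 0" by blast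
  then have "0 < \<epsilon>" "\<epsilon> < d" "\<not> eigenvalue M (- complex_of_real \<epsilon>)"
    by (simp_all add: eigenvalue_root_char_poly[OF M])
  then show thesis using that M by (auto simp: eigenvalue_det[OF M] char_matrix_def)
qed

subsection \<open>A single block\<close>

text \<open>Identifies an infimum that may fail to be attained. The two assumptions also make the
  set bounded below and nonempty, without which \<open>Inf\<close> on the reals says
  nothing.\<close>

lemma real_cInf_eq_approx:
  fixes S :: "real set"
  assumes lower: "\<And>x. x \<in> S \<Longrightarrow> v \<le> x" and approx: "\<And>e. e > 0 \<Longrightarrow> \<exists>x\<in>S. x < v + e"
  shows "Inf S = v"
proof (rule antisym)
  have "S \<noteq> {}" using approx[of 1] by auto
  then show "v \<le> Inf S" using lower by (rule cInf_greatest)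
  have bdd: "bdd_below S" using lower by (rule bdd_belowI)
  show "Inf S \<le> v"
  proof (rule field_le_epsilon)
    fix e :: real assume "e > 0"
    from approx[OF this] obtain x where "x \<in> S" "x < v + e" by blast
    then show "Inf S \<le> v + e" using cInf_lower[OF _ bdd, of x] by simp
  qed
qed

section \<open>Euclidean norm, spectral norm and the block rows of V\<close>

lemma euclidean_norm_sq: "(euclidean_norm v)\<^sup>2 = (\<Sum>a<dim_vec v. (cmod (v $ a))\<^sup>2)"
  by (simp add: euclidean_norm_def sum_nonneg)

lemma euclidean_norm_nonneg [simp]: "euclidean_norm v \<ge> 0"
  by (simp add: euclidean_norm_def sum_nonneg)

lemma euclidean_norm_smult: "euclidean_norm (c \<cdot>\<^sub>v v) = cmod c * euclidean_norm v"
  by (simp add: euclidean_norm_def norm_mult power_mult_distrib real_sqrt_mult flip: sum_distrib_left)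

lemma euclidean_norm_pos:
  assumes "v \<in> carrier_vec n" "v \<noteq> 0\<^sub>v n"
  shows "euclidean_norm v > 0"
proof -
  obtain a where a: "a < n" "v $ a \<noteq> 0"
    using assms by (metis carrier_vecD eq_vecI index_zero_vec)
  have "0 < (cmod (v $ a))\<^sup>2" using a by simp
  also have "\<dots> \<le> (\<Sum>i<n. (cmod (v $ i))\<^sup>2)"
    by (rule member_le_sum) (use a in auto)
  finally show ?thesis using assms(1) by (simp add: euclidean_norm_def)
qed

text \<open>Scaled to length 1, x contributes a member of the set whose supremum is the spectral
  norm. The assumption \<open>contr\<close> bounds that set, so that the supremum really is an upper
  bound.\<close>

lemma spectral_norm_less_one:
  assumes M: "M \<in> carrier_mat p q" and less: "spectral_norm M < 1"
    and contr: "\<And>x. x \<in> carrier_vec q \<Longrightarrow> euclidean_norm (M *\<^sub>v x) \<le> euclidean_norm x"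
    and x: "x \<in> carrier_vec q" "x \<noteq> 0\<^sub>v q"
  shows "euclidean_norm (M *\<^sub>v x) < euclidean_norm x"
proof -
  let ?S = "{euclidean_norm (M *\<^sub>v x) | x. x \<in> carrier_vec (dim_col M) \<and> euclidean_norm x \<le> 1}"
  have pos: "euclidean_norm x > 0" by (rule euclidean_norm_pos[OF x])
  define c where "c = complex_of_real (1 / euclidean_norm x)"
  have c: "cmod c = 1 / euclidean_norm x" using pos by (simp add: c_def norm_divide)
  have "bdd_above ?S"
  proof (rule bdd_aboveI)
    fix y assume "y \<in> ?S"
    then show "y \<le> 1" using contr M by fastforce
  qed
  moreover have "euclidean_norm (M *\<^sub>v (c \<cdot>\<^sub>v x)) \<in> ?S"
    using x M pos by (auto simp: euclidean_norm_smult c)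
  ultimately have "euclidean_norm (M *\<^sub>v (c \<cdot>\<^sub>v x)) \<le> spectral_norm M"
    unfolding spectral_norm_def by (rule cSup_upper[rotated])
  then have "euclidean_norm (M *\<^sub>v x) / euclidean_norm x < 1"
    using less by (simp add: mult_mat_vec[OF M x(1)] euclidean_norm_smult c)
  then show ?thesis using pos by (simp add: divide_less_eq)
qed

lemma V_block_carrier [simp, intro]: "V_block n V r \<in> carrier_mat n n"
  by (simp add: V_block_def)

text \<open>Pad x with zeros to length \<open>q * n\<close>: the unitary \<open>V\<close> preserves
  its norm, only the first \<open>n\<close> columns of \<open>V\<close> act on it, and the rows of
  the image are grouped into \<open>q\<close> blocks of \<open>n\<close>.\<close>

lemma sum_euclidean_norm_V_block:
  fixes V :: "complex mat"
  assumes V: "V \<in> carrier_mat (q * n) (q * n)" and iso: "mat_adjoint V * V = 1\<^sub>m (q * n)"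
    and q: "q > 0" and x: "x \<in> carrier_vec n"
  shows "(\<Sum>r<q. (euclidean_norm (V_block n V (r + 1) *\<^sub>v x))\<^sup>2) = (euclidean_norm x)\<^sup>2"
proof -
  let ?X = "mat (q * n) 1 (\<lambda>(i, _). if i < n then x $ i else 0)"
  have X: "?X \<in> carrier_mat (q * n) 1" by simp
  have nq: "n \<le> q * n" using q by simp
  have VX: "(V * ?X) $$ (r * n + d, 0) = (V_block n V (r + 1) *\<^sub>v x) $ d" if r: "r < q" and d: "d < n" for r d
  proof -
    have "r * n + d < (r + 1) * n" using d by simp
    also have "\<dots> \<le> q * n" using r by (intro mult_right_mono) auto
    finally have rd: "r * n + d < q * n" .
    have "(V * ?X) $$ (r * n + d, 0) = (\<Sum>l<q * n. V $$ (r * n + d, l) * ?X $$ (l, 0))"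
      by (rule mat_mult_index[OF V X rd]) simp
    also have "\<dots> = (\<Sum>l<n. V $$ (r * n + d, l) * ?X $$ (l, 0))"
      by (rule sum.mono_neutral_right) (use nq in auto)
    also have "\<dots> = (\<Sum>l<n. V $$ (r * n + d, l) * x $ l)"
      by (rule sum.cong) (use order.strict_trans2[OF _ nq] in auto)
    also have "\<dots> = (V_block n V (r + 1) *\<^sub>v x) $ d"
      using d x by (auto simp: V_block_def scalar_prod_def atLeast0LessThan intro!: sum.cong)
    finally show ?thesis .
  qed
  have "(\<Sum>r<q. (euclidean_norm (V_block n V (r + 1) *\<^sub>v x))\<^sup>2)
      = (\<Sum>r<q. \<Sum>d<n. (cmod ((V * ?X) $$ (r * n + d, 0)))\<^sup>2)"
  proof (rule sum.cong[OF refl])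
    fix r assume "r \<in> {..<q}"
    then have r: "r < q" by simp
    have dim: "dim_vec (V_block n V (r + 1) *\<^sub>v x) = n" by (simp add: V_block_def)
    show "(euclidean_norm (V_block n V (r + 1) *\<^sub>v x))\<^sup>2
      = (\<Sum>d<n. (cmod ((V * ?X) $$ (r * n + d, 0)))\<^sup>2)"
      unfolding euclidean_norm_sq dim by (rule sum.cong) (simp_all only: VX[OF r] lessThan_iff)
  qed
  also have "\<dots> = (\<Sum>r<q. \<Sum>b=r * n..<r * n + n. (cmod ((V * ?X) $$ (b, 0)))\<^sup>2)"
  proof (rule sum.cong[OF refl])
    fix r
    show "(\<Sum>d<n. (cmod ((V * ?X) $$ (r * n + d, 0)))\<^sup>2) = (\<Sum>b=r * n..<r * n + n. (cmod ((V * ?X) $$ (b, 0)))\<^sup>2)"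
      using sum.shift_bounds_nat_ivl[of "\<lambda>b. (cmod ((V * ?X) $$ (b, 0)))\<^sup>2" 0 "r * n" n]
      by (simp add: atLeast0LessThan add.commute del: index_mult_mat(1))
  qed
  also have "\<dots> = (\<Sum>b<q * n. (cmod ((V * ?X) $$ (b, 0)))\<^sup>2)" by (rule sum.nat_group)
  also have "\<dots> = frob_sq (V * ?X)" using V by (simp add: frob_sq_def)
  also have "\<dots> = frob_sq ?X" by (rule frob_sq_isometry_mult[OF V X iso])
  also have "\<dots> = (\<Sum>i<q * n. if i < n then (cmod (x $ i))\<^sup>2 else 0)"
    unfolding frob_sq_def by (auto intro!: sum.cong)
  also have "\<dots> = (\<Sum>i<n. if i < n then (cmod (x $ i))\<^sup>2 else 0)"
    by (rule sum.mono_neutral_right) (use nq in auto)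
  also have "\<dots> = (euclidean_norm x)\<^sup>2"
    unfolding euclidean_norm_sq using x by (intro sum.cong) auto
  finally show ?thesis .
qed

section \<open>One block with a fixed partitioned SVD\<close>

locale svd_block =
  fixes k m n :: nat and A :: "complex mat" and B :: "nat \<Rightarrow> complex mat"
    and U1 U2 V :: "complex mat" and S1 S2 :: "real mat"
  assumes k: "k \<ge> 1" and nm: "n \<le> m" and A: "A \<in> carrier_mat m n"
    and B: "s \<in> {1..k} \<Longrightarrow> B s \<in> carrier_mat m n"
    and svd: "partitioned_svd k m n (aug k m A B) U1 U2 S1 S2 V"
begin

definition tail :: real where
  "tail = (\<Sum>j = n + 1..min m ((k + 1) * n). (singular_value (aug k m A B) j)\<^sup>2)"

definition P :: "complex mat" where
  "P = U1 * map_mat complex_of_real S1"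

definition W :: "nat \<Rightarrow> complex mat" where
  "W r = mat_adjoint (V_block n V r)"

lemma C: "aug k m A B \<in> carrier_mat m ((k + 1) * n)"
  by (rule aug_carrier[OF A]) (rule B)

lemma V: "V \<in> carrier_mat ((k + 1) * n) ((k + 1) * n)"
  and isoV: "mat_adjoint V * V = 1\<^sub>m ((k + 1) * n)"
  and U1: "U1 \<in> carrier_mat m n" and S1: "S1 \<in> carrier_mat n n"
  using svd unfolding partitioned_svd_def Let_def by auto

lemma P: "P \<in> carrier_mat m n"
  using U1 S1 by (auto simp: P_def)

lemma W [simp, intro]: "W r \<in> carrier_mat n n"
  by (simp add: W_def mat_adjoint_carrier[OF V_block_carrier])

lemma cost_block_diff:
  assumes "Ah \<in> carrier_mat m n" "\<And>s. s \<in> {1..k} \<Longrightarrow> Bh s \<in> carrier_mat m n"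
  shows "cost_block k m A B Ah Bh = frob_sq (aug k m Ah Bh - aug k m A B)"
  unfolding cost_block_def frobenius_norm_sq
  by (subst aug_minus[of A m n k B Ah Bh]) (use A B assms in auto)

text \<open>The rank constraint factors the feasible concatenation through at most \<open>n\<close>
  orthonormal columns, which is the situation of \<open>eckart_young_bound\<close>.\<close>

lemma tail_le_cost_block:
  assumes "feasible_block k m n Ah Bh X"
  shows "tail \<le> cost_block k m A B Ah Bh"
proof -
  let ?t = "min m ((k + 1) * n)" and ?N = "(k + 1) * n"
  have Ah: "Ah \<in> carrier_mat m n" and Bh: "\<And>s. s \<in> {1..k} \<Longrightarrow> Bh s \<in> carrier_mat m n"
    and rank: "vec_space.rank m (aug k m Ah Bh) \<le> n"
    using assms by (auto simp: feasible_block_def)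
  have D: "aug k m Ah Bh \<in> carrier_mat m ((k + 1) * n)" by (rule aug_carrier[OF Ah]) (rule Bh)
  obtain Q Y where QY: "Q \<in> carrier_mat m (vec_space.rank m (aug k m Ah Bh))"
    "Y \<in> carrier_mat (vec_space.rank m (aug k m Ah Bh)) ((k + 1) * n)"
    "mat_adjoint Q * Q = 1\<^sub>m (vec_space.rank m (aug k m Ah Bh))" "aug k m Ah Bh = Q * Y"
    using rank_factorization_isometry[OF D] by blast
  obtain U s \<tau> where U: "U \<in> carrier_mat m ?t" "mat_adjoint U * U = 1\<^sub>m ?t"
    and eq: "aug k m A B = U * rect_diag ?t ?N s * mat_adjoint V"
    and U1_eq: "\<And>a l. a < m \<Longrightarrow> l < n \<Longrightarrow> U $$ (a, l) = U1 $$ (a, l)"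
    and S1_eq: "\<And>a l. a < n \<Longrightarrow> l < n \<Longrightarrow> S1 $$ (a, l) = (if a = l then s l else 0)"
    and \<tau>: "\<tau> \<ge> 0" "\<And>l. l < n \<Longrightarrow> \<tau> \<le> (s l)\<^sup>2" "\<And>l. n \<le> l \<Longrightarrow> l < ?t \<Longrightarrow> (s l)\<^sup>2 \<le> \<tau>"
    and tail: "(\<Sum>l=n..<?t. (s l)\<^sup>2) = tail"
    by (rule partitioned_svd_rect_diag[OF svd nm C, folded tail_def]) (rule that)
  have "tail \<le> frob_sq (aug k m A B - aug k m Ah Bh)"
    unfolding tail[symmetric] eq QY(4)
    by (rule eckart_young_bound[OF U(1) V _ U(2) isoV QY(1-3) rank _ \<tau>]) (use nm in auto)
  also have "\<dots> = frob_sq (aug k m Ah Bh - aug k m A B)"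
    unfolding frob_sq_def using C D by (auto simp: norm_minus_commute intro!: sum.cong)
  finally show ?thesis using cost_block_diff[of Ah Bh] Ah Bh by simp
qed

text \<open>The error is again of the form U S V^H, with the first \<open>n\<close> diagonal entries
  replaced by 0 and the others negated, so \<open>frob_sq_svd\<close> evaluates it.\<close>

lemma cost_block_truncation: "cost_block k m A B (P * W 1) (\<lambda>s. P * W (s + 1)) = tail"
proof -
  let ?t = "min m ((k + 1) * n)" and ?N = "(k + 1) * n"
  obtain U s \<tau> where U: "U \<in> carrier_mat m ?t" "mat_adjoint U * U = 1\<^sub>m ?t"
    and eq: "aug k m A B = U * rect_diag ?t ?N s * mat_adjoint V"
    and U1_eq: "\<And>a l. a < m \<Longrightarrow> l < n \<Longrightarrow> U $$ (a, l) = U1 $$ (a, l)"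
    and S1_eq: "\<And>a l. a < n \<Longrightarrow> l < n \<Longrightarrow> S1 $$ (a, l) = (if a = l then s l else 0)"
    and \<tau>: "\<tau> \<ge> 0" "\<And>l. l < n \<Longrightarrow> \<tau> \<le> (s l)\<^sup>2" "\<And>l. n \<le> l \<Longrightarrow> l < ?t \<Longrightarrow> (s l)\<^sup>2 \<le> \<tau>"
    and tail: "(\<Sum>l=n..<?t. (s l)\<^sup>2) = tail"
    by (rule partitioned_svd_rect_diag[OF svd nm C, folded tail_def]) (rule that)
  have nt: "n \<le> ?t" "?t \<le> ?N" using nm by auto
  define s' where "s' l = (if l < n then 0 else - s l)" for l
  have P_index: "P $$ (a, l) = U $$ (a, l) * complex_of_real (s l)" if al: "a < m" "l < n" for a l
  proof -
    have "P $$ (a, l) = (\<Sum>j<n. U1 $$ (a, j) * map_mat complex_of_real S1 $$ (j, l))"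
      unfolding P_def by (rule mat_mult_index[OF U1 _ al]) (use S1 in auto)
    also have "\<dots> = (\<Sum>j<n. if j = l then U1 $$ (a, j) * complex_of_real (s j) else 0)"
      by (rule sum.cong) (use S1 S1_eq al in auto)
    finally show ?thesis using al U1_eq by simp
  qed
  have PW: "P * W 1 \<in> carrier_mat m n" "\<And>s. P * W (s + 1) \<in> carrier_mat m n"
    using P by (auto intro!: mult_carrier_mat)
  have D: "aug k m (P * W 1) (\<lambda>s. P * W (s + 1)) \<in> carrier_mat m ?N"
    by (rule aug_carrier[OF PW(1)]) (rule PW(2))
  have "aug k m (P * W 1) (\<lambda>s. P * W (s + 1)) - aug k m A B = U * rect_diag ?t ?N s' * mat_adjoint V"
  proof (rule eq_matI)
    fix a b assume "a < dim_row (U * rect_diag ?t ?N s' * mat_adjoint V)"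
      "b < dim_col (U * rect_diag ?t ?N s' * mat_adjoint V)"
    then have ab: "a < m" "b < ?N" using U V by auto
    then have n: "n > 0" by (cases n) auto
    have "aug k m (P * W 1) (\<lambda>s. P * W (s + 1)) $$ (a, b)
        = (if b div n = 0 then P * W 1 else P * W (b div n + 1)) $$ (a, b mod n)"
      by (rule aug_index[of "P * W 1" m n k "\<lambda>s. P * W (s + 1)"]) (use PW ab in auto)
    \<comment> \<open>Block 0 carries \<open>W 1\<close> and block s carries
      \<open>W (s + 1)\<close>, so a single shifted index covers both cases.\<close>
    also have "\<dots> = (P * W (b div n + 1)) $$ (a, b mod n)" by simp
    also have "\<dots> = (\<Sum>l<n. P $$ (a, l) * W (b div n + 1) $$ (l, b mod n))"
      by (rule mat_mult_index[OF P W ab(1)]) (use n in simp)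
    also have "\<dots> = (\<Sum>l<n. U $$ (a, l) * complex_of_real (s l) * cnj (V $$ (b, l)))"
      by (rule sum.cong) (use n ab P_index in \<open>auto simp: W_def V_block_def\<close>)
    finally have 1: "aug k m (P * W 1) (\<lambda>s. P * W (s + 1)) $$ (a, b)
        = (\<Sum>l<n. U $$ (a, l) * complex_of_real (s l) * cnj (V $$ (b, l)))" .
    have split: "(\<Sum>l<?t. f l) = (\<Sum>l<n. f l) + (\<Sum>l=n..<?t. f l)" for f :: "nat \<Rightarrow> complex"
      using sum.atLeastLessThan_concat[of 0 n ?t f] nt by (simp add: atLeast0LessThan)
    have "(U * rect_diag ?t ?N s' * mat_adjoint V) $$ (a, b)
        = (\<Sum>l<?t. U $$ (a, l) * complex_of_real (s' l) * cnj (V $$ (b, l)))"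
      by (rule svd_index[OF U(1) V nt(2) ab])
    also have "\<dots> = - (\<Sum>l=n..<?t. U $$ (a, l) * complex_of_real (s l) * cnj (V $$ (b, l)))"
      unfolding split by (simp add: s'_def sum_negf)
    also have "\<dots> = aug k m (P * W 1) (\<lambda>s. P * W (s + 1)) $$ (a, b) - aug k m A B $$ (a, b)"
      unfolding 1 eq svd_index[OF U(1) V nt(2) ab] split by simp
    finally show "(aug k m (P * W 1) (\<lambda>s. P * W (s + 1)) - aug k m A B) $$ (a, b)
        = (U * rect_diag ?t ?N s' * mat_adjoint V) $$ (a, b)"
      using ab C D by simp
  qed (use C D U V in auto)
  moreover have "frob_sq (U * rect_diag ?t ?N s' * mat_adjoint V) = (\<Sum>l<?t. (s' l)\<^sup>2)"
    by (rule frob_sq_svd[OF U(1) V nt(2) U(2) isoV])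
  moreover have "(\<Sum>l<?t. (s' l)\<^sup>2) = (\<Sum>l=n..<?t. (s' l)\<^sup>2)"
    by (rule sum.mono_neutral_right) (auto simp: s'_def)
  moreover have "\<dots> = tail" unfolding tail[symmetric] by (simp add: s'_def)
  ultimately show ?thesis using cost_block_diff[of "P * W 1" "\<lambda>s. P * W (s + 1)"] PW by simp
qed

text \<open>\<open>G\<close> is the Gram matrix of the block column formed by \<open>Vb 1\<close> to
  \<open>Vb k\<close>. A kernel vector of it would keep its full length under \<open>Vb 0\<close>,
  which the norm condition excludes.\<close>

lemma attained:
  assumes norm: "spectral_norm (V_block n V 1) < 1"
  shows "\<exists>X. feasible_block k m n (P * W 1) (\<lambda>s. P * W (s + 1)) X"
proof -
  define Vb where "Vb s = V_block n V (s + 1)" for s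
  have Vb: "Vb s \<in> carrier_mat n n" for s by (simp add: Vb_def)
  have W_Vb: "W (s + 1) = mat_adjoint (Vb s)" for s by (simp add: W_def Vb_def)
  define G where "G = mat_sum n n (\<lambda>s. W (s + 1) * Vb s) {1..k}"
  have G: "G \<in> carrier_mat n n" by (simp add: G_def)
  have isometry: "(euclidean_norm (Vb 0 *\<^sub>v x))\<^sup>2 + (\<Sum>s=1..k. (euclidean_norm (Vb s *\<^sub>v x))\<^sup>2)
      = (euclidean_norm x)\<^sup>2" if "x \<in> carrier_vec n" for x
  proof -
    have "(\<Sum>r<k + 1. (euclidean_norm (Vb r *\<^sub>v x))\<^sup>2) = (euclidean_norm x)\<^sup>2"
      unfolding Vb_def by (rule sum_euclidean_norm_V_block[OF V isoV _ that]) simp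
    then show ?thesis
      using sum.lessThan_Suc_shift[of "\<lambda>r. (euclidean_norm (Vb r *\<^sub>v x))\<^sup>2" k]
        sum.shift_bounds_Suc_ivl[of "\<lambda>r. (euclidean_norm (Vb r *\<^sub>v x))\<^sup>2" 0 k]
      by (simp add: atLeast0LessThan atLeastLessThanSuc_atLeastAtMost)
  qed
  \<comment> \<open>\<open>Vb 0\<close> is part of an isometry; this contraction property is what
    \<open>spectral_norm_less_one\<close> asks for.\<close>
  have contr: "euclidean_norm (Vb 0 *\<^sub>v x) \<le> euclidean_norm x" if "x \<in> carrier_vec n" for x
  proof -
    have "(\<Sum>s=1..k. (euclidean_norm (Vb s *\<^sub>v x))\<^sup>2) \<ge> 0" by (intro sum_nonneg) simp
    then have "(euclidean_norm (Vb 0 *\<^sub>v x))\<^sup>2 \<le> (euclidean_norm x)\<^sup>2"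
      using isometry[OF that] by linarith
    then show ?thesis by (rule power2_le_imp_le) simp
  qed
  have "det G \<noteq> 0"
  proof
    assume "det G = 0"
    then obtain x where x: "x \<in> carrier_vec n" "x \<noteq> 0\<^sub>v n" "G *\<^sub>v x = 0\<^sub>v n"
      using det_0_iff_vec_prod_zero[OF G] by blast
    define X where "X = mat n 1 (\<lambda>(i, _). x $ i)"
    have X: "X \<in> carrier_mat n 1" by (simp add: X_def)
    have mult_X: "(M * X) $$ (i, 0) = (M *\<^sub>v x) $ i" if "M \<in> carrier_mat n n" "i < n" for M i
      using that x(1) X by (subst mat_mult_index[OF that(1) X that(2)])
        (auto simp: X_def scalar_prod_def atLeast0LessThan intro!: sum.cong)
    have "G * X = 0\<^sub>m n 1"
    proof (rule eq_matI)
      fix i j assume "i < dim_row (0\<^sub>m n 1 :: complex mat)" "j < dim_col (0\<^sub>m n 1 :: complex mat)"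
      then show "(G * X) $$ (i, j) = 0\<^sub>m n 1 $$ (i, j)"
        using mult_X[OF G, of i] x(3) by (simp del: index_mult_mat(1))
    qed (use G X in auto)
    have XX: "mat_adjoint (Vb s * X) * (Vb s * X) = mat_adjoint X * (W (s + 1) * Vb s * X)" for s
    proof -
      have "mat_adjoint (Vb s * X) * (Vb s * X) = mat_adjoint X * W (s + 1) * (Vb s * X)"
        unfolding W_Vb mat_adjoint_mult[OF Vb X] ..
      also have "\<dots> = mat_adjoint X * (W (s + 1) * (Vb s * X))"
        by (rule assoc_mult_mat[OF mat_adjoint_carrier[OF X] W mult_carrier_mat[OF Vb X]])
      also have "W (s + 1) * (Vb s * X) = W (s + 1) * Vb s * X"
        by (rule assoc_mult_mat[symmetric, OF W Vb X])
      finally show ?thesis .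
    qed
    have norm_X: "(euclidean_norm (Vb s *\<^sub>v x))\<^sup>2 = frob_sq (Vb s * X)" for s
    proof -
      have dims: "dim_row (Vb s * X) = n" "dim_col (Vb s * X) = 1" "dim_vec (Vb s *\<^sub>v x) = n"
        using Vb[of s] X by auto
      show ?thesis unfolding euclidean_norm_sq frob_sq_def dims by (simp add: mult_X[OF Vb] del: index_mult_mat(1) index_mult_mat_vec)
    qed
    \<comment> \<open>Evaluate x^H G x in two ways: it is 0 since G x = 0, and it is the sum of the
      squared norms of \<open>Vb s *\<^sub>v x\<close>.\<close>
    have "mat_sum 1 1 (\<lambda>s. mat_adjoint X * (W (s + 1) * Vb s * X)) {1..k}
        = mat_adjoint X * mat_sum n 1 (\<lambda>s. W (s + 1) * Vb s * X) {1..k}"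
      by (rule mat_sum_mult_left[OF mat_adjoint_carrier[OF X]])
        (rule mult_carrier_mat[OF mult_carrier_mat[OF W Vb] X])
    also have "mat_sum n 1 (\<lambda>s. W (s + 1) * Vb s * X) {1..k} = G * X"
      unfolding G_def by (rule mat_sum_mult_right[OF X]) (rule mult_carrier_mat[OF W Vb])
    also have "mat_adjoint X * (G * X) = 0\<^sub>m 1 1"
      unfolding \<open>G * X = 0\<^sub>m n 1\<close> by (rule right_mult_zero_mat[OF mat_adjoint_carrier[OF X]])
    finally have "mat_sum 1 1 (\<lambda>s. mat_adjoint X * (W (s + 1) * Vb s * X)) {1..k} $$ (0, 0) = 0"
      by simp
    then have "(\<Sum>s=1..k. (mat_adjoint (Vb s * X) * (Vb s * X)) $$ (0, 0)) = 0"
      unfolding XX by (simp add: mat_sum_def del: index_mult_mat(1))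
    moreover have "(mat_adjoint (Vb s * X) * (Vb s * X)) $$ (0, 0) = complex_of_real (frob_sq (Vb s * X))" for s
      unfolding frob_sq_trace using X by (simp add: mat_trace_def del: index_mult_mat(1))
    ultimately have "complex_of_real (\<Sum>s=1..k. frob_sq (Vb s * X)) = 0" by simp
    then have "(\<Sum>s=1..k. (euclidean_norm (Vb s *\<^sub>v x))\<^sup>2) = 0"
      unfolding norm_X of_real_eq_0_iff .
    moreover have "euclidean_norm (Vb 0 *\<^sub>v x) < euclidean_norm x"
      by (rule spectral_norm_less_one[OF Vb _ contr x(1,2)]) (use norm in \<open>simp_all add: Vb_def\<close>)
    then have "(euclidean_norm (Vb 0 *\<^sub>v x))\<^sup>2 < (euclidean_norm x)\<^sup>2"
      by (simp add: power_strict_mono)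
    ultimately show False using isometry[OF x(1)] by simp
  qed
  then obtain R where R: "R \<in> carrier_mat n n" "G * R = 1\<^sub>m n"
    using det_nonzero_right_inverse[OF G] by blast
  \<comment> \<open>With H the row of the blocks \<open>W 2\<close> to \<open>W (k + 1)\<close>,
    this is the right inverse H^H (H H^H)^-1 applied to \<open>W 1\<close>, where H H^H is
    \<open>G\<close>.\<close>
  define X where "X s = Vb s * (R * W 1)" for s
  have RW: "R * W 1 \<in> carrier_mat n n" using R(1) by (rule mult_carrier_mat) simp
  have "mat_sum n n (\<lambda>s. W (s + 1) * X s) {1..k} = mat_sum n n (\<lambda>s. W (s + 1) * Vb s * (R * W 1)) {1..k}"
    unfolding X_def by (rule mat_sum_cong) (rule assoc_mult_mat[symmetric, OF W Vb RW])
  also have "\<dots> = G * (R * W 1)"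
    unfolding G_def by (rule mat_sum_mult_right[OF RW]) (rule mult_carrier_mat[OF W Vb])
  also have "\<dots> = G * R * W 1" by (rule assoc_mult_mat[symmetric, OF G R(1) W])
  also have "\<dots> = W 1" unfolding R(2) by (rule left_mult_one_mat[OF W])
  finally have "W 1 = mat_sum n n (\<lambda>s. W (s + 1) * X s) {1..k}" by simp
  then show ?thesis
    using feasible_block_mult_left[of P m n k "\<lambda>s. W (s + 1)" X, OF P W] mult_carrier_mat[OF Vb RW]
    unfolding X_def by blast
qed

text \<open>Adding \<open>\<epsilon> P\<close> to the first block \<open>P W\<^sub>2\<close> makes its right factor invertible for all but
  finitely many \<open>\<epsilon>\<close>, and the cost depends continuously on \<open>\<epsilon>\<close>.\<close>

lemma approximately_attained:
  assumes e: "e > 0"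
  shows "\<exists>Ah Bh X. feasible_block k m n Ah Bh X \<and> cost_block k m A B Ah Bh < tail + e"
proof -
  let ?N = "(k + 1) * n"
  \<comment> \<open>Only the factor belonging to the first B-block moves; that block exists because
    \<open>k \<ge> 1\<close>.\<close>
  define W' where "W' \<epsilon> s = (if s = 1 then W 2 + complex_of_real \<epsilon> \<cdot>\<^sub>m 1\<^sub>m n else W (s + 1))" for \<epsilon> s
  have W': "W' \<epsilon> s \<in> carrier_mat n n" for \<epsilon> s by (simp add: W'_def)
  have PW: "P * W r \<in> carrier_mat m n" for r using P W by (rule mult_carrier_mat)
  have PW': "P * W' \<epsilon> s \<in> carrier_mat m n" for \<epsilon> s using P W' by (rule mult_carrier_mat)
  define E where "E = aug k m (P * W 1) (\<lambda>s. P * W (s + 1)) - aug k m A B"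
  \<comment> \<open>The direction of the perturbation: \<open>P\<close> in the columns of the first
    B-block. The error is then affine in \<epsilon>, and its squared norm \<open>f\<close> is
    continuous.\<close>
  define F where "F = mat m ?N (\<lambda>(a, b). if b div n = 1 then P $$ (a, b mod n) else 0)"
  define f where "f \<epsilon> = (\<Sum>a<m. \<Sum>b<?N. (cmod (E $$ (a, b) + complex_of_real \<epsilon> * F $$ (a, b)))\<^sup>2)" for \<epsilon>
  have D: "aug k m (P * W 1) (\<lambda>s. P * W (s + 1)) \<in> carrier_mat m ?N"
    by (rule aug_carrier[OF PW]) (rule PW)
  have D': "aug k m (P * W 1) (\<lambda>s. P * W' \<epsilon> s) \<in> carrier_mat m ?N" for \<epsilon>
    by (rule aug_carrier[OF PW]) (rule PW')
  have cost: "cost_block k m A B (P * W 1) (\<lambda>s. P * W' \<epsilon> s) = f \<epsilon>" for \<epsilon>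
  proof -
    have "(aug k m (P * W 1) (\<lambda>s. P * W' \<epsilon> s) - aug k m A B) $$ (a, b)
        = E $$ (a, b) + complex_of_real \<epsilon> * F $$ (a, b)" if ab: "a < m" "b < ?N" for a b
    proof -
      have n: "n > 0" using ab by (cases n) auto
      have "P * (W 2 + complex_of_real \<epsilon> \<cdot>\<^sub>m 1\<^sub>m n) = P * W 2 + P * (complex_of_real \<epsilon> \<cdot>\<^sub>m 1\<^sub>m n)"
        by (rule mult_add_distrib_mat[OF P W]) simp
      also have "P * (complex_of_real \<epsilon> \<cdot>\<^sub>m 1\<^sub>m n) = complex_of_real \<epsilon> \<cdot>\<^sub>m P"
        unfolding mult_smult_distrib[OF P one_carrier_mat] right_mult_one_mat[OF P] ..
      finally have first: "P * W' \<epsilon> 1 = P * W 2 + complex_of_real \<epsilon> \<cdot>\<^sub>m P" by (simp add: W'_def)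
      have "aug k m (P * W 1) (\<lambda>s. P * W' \<epsilon> s) $$ (a, b)
          = (if b div n = 0 then P * W 1 else P * W' \<epsilon> (b div n)) $$ (a, b mod n)"
        by (rule aug_index[of "P * W 1" m n k "\<lambda>s. P * W' \<epsilon> s"]) (use PW PW' ab in auto)
      also have "\<dots> = (if b div n = 0 then P * W 1 else P * W (b div n + 1)) $$ (a, b mod n)
          + complex_of_real \<epsilon> * F $$ (a, b)"
      proof (cases "b div n = 1")
        case True
        then show ?thesis
          using ab n PW[of 2] P unfolding True first
          by (simp add: True[simplified] F_def numeral_2_eq_2 del: index_mult_mat(1))
      next
        case False
        then show ?thesis using ab by (simp add: W'_def F_def)
      qed
      also have "(if b div n = 0 then P * W 1 else P * W (b div n + 1)) $$ (a, b mod n)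
          = aug k m (P * W 1) (\<lambda>s. P * W (s + 1)) $$ (a, b)"
        by (rule aug_index[of "P * W 1" m n k "\<lambda>s. P * W (s + 1)", symmetric]) (use PW ab in auto)
      finally show ?thesis using ab C D D' by (simp add: E_def)
    qed
    then show ?thesis
      using cost_block_diff[of "P * W 1" "\<lambda>s. P * W' \<epsilon> s"] PW PW' C D'
      by (simp add: frob_sq_def f_def)
  qed
  have "f 0 = tail"
    using cost_block_truncation cost_block_diff[of "P * W 1" "\<lambda>s. P * W (s + 1)"] PW C D
    by (simp add: f_def E_def frob_sq_def)
  moreover have "isCont f 0" unfolding f_def by (intro continuous_intros)
  ultimately have "(f \<longlongrightarrow> tail) (at 0)" by (simp add: isCont_def)
  then have "eventually (\<lambda>\<epsilon>. f \<epsilon> < tail + e) (at 0)" by (rule order_tendstoD(2)) (use e in simp)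
  then obtain d where d: "d > 0" "\<And>\<epsilon>. \<epsilon> \<noteq> 0 \<Longrightarrow> dist \<epsilon> 0 < d \<Longrightarrow> f \<epsilon> < tail + e"
    by (auto simp: eventually_at)
  \<comment> \<open>The same \<open>d\<close> limits the increase of the cost and the search
    interval, so one positive \<epsilon> serves both purposes.\<close>
  obtain \<epsilon> where \<epsilon>: "0 < \<epsilon>" "\<epsilon> < d" "det (W 2 + complex_of_real \<epsilon> \<cdot>\<^sub>m 1\<^sub>m n) \<noteq> 0"
    using det_add_smult_one_nonzero[OF W d(1)] by blast
  have W'1: "W' \<epsilon> 1 = W 2 + complex_of_real \<epsilon> \<cdot>\<^sub>m 1\<^sub>m n" by (simp add: W'_def)
  obtain R where R: "R \<in> carrier_mat n n" "W' \<epsilon> 1 * R = 1\<^sub>m n"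
    using det_nonzero_right_inverse[OF W'[of \<epsilon> 1]] \<epsilon>(3) unfolding W'1 by blast
  \<comment> \<open>The invertible factor alone already reproduces \<open>W 1\<close>, so the
    remaining unknowns are set to zero.\<close>
  define X where "X s = (if s = 1 then R * W 1 else 0\<^sub>m n n)" for s :: nat
  have X: "X s \<in> carrier_mat n n" for s using mult_carrier_mat[OF R(1) W] by (simp add: X_def)
  have X1: "W' \<epsilon> 1 * X 1 = W 1"
    unfolding X_def using R(2) by (simp add: assoc_mult_mat[OF W' R(1) W, symmetric] left_mult_one_mat[OF W])
  have WX: "W' \<epsilon> s * X s = (if s = 1 then W 1 else 0\<^sub>m n n)" for s
    using X1 right_mult_zero_mat[OF W'[of \<epsilon> s]] by (auto simp: X_def)
  have "W 1 = mat_sum n n (\<lambda>s. W' \<epsilon> s * X s) {1..k}"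
  proof (rule eq_matI)
    fix a b assume "a < dim_row (mat_sum n n (\<lambda>s. W' \<epsilon> s * X s) {1..k})"
      "b < dim_col (mat_sum n n (\<lambda>s. W' \<epsilon> s * X s) {1..k})"
    then have ab: "a < n" "b < n" by (auto simp: mat_sum_def)
    have "mat_sum n n (\<lambda>s. W' \<epsilon> s * X s) {1..k} $$ (a, b) = (\<Sum>s=1..k. (if s = 1 then W 1 else 0\<^sub>m n n) $$ (a, b))"
      unfolding WX using ab by (simp add: mat_sum_def)
    also have "\<dots> = (\<Sum>s=1..k. if s = 1 then W 1 $$ (a, b) else 0)"
      by (rule sum.cong) (use ab in auto)
    finally show "W 1 $$ (a, b) = mat_sum n n (\<lambda>s. W' \<epsilon> s * X s) {1..k} $$ (a, b)"
      using k by simp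
  qed (use W[of 1] in \<open>auto simp: mat_sum_def simp del: W\<close>)
  then have "feasible_block k m n (P * W 1) (\<lambda>s. P * W' \<epsilon> s) X"
    by (intro feasible_block_mult_left[OF P W' X])
  moreover have "cost_block k m A B (P * W 1) (\<lambda>s. P * W' \<epsilon> s) < tail + e"
    unfolding cost using d(2)[of \<epsilon>] \<epsilon> by simp
  ultimately show ?thesis by blast
qed

lemma phi_block_eq: "phi_block k m n A B = tail"
  unfolding phi_block_def
proof (rule real_cInf_eq_approx)
  fix x assume "x \<in> {cost_block k m A B Ah Bh |Ah Bh X. feasible_block k m n Ah Bh X}"
  then show "tail \<le> x" using tail_le_cost_block by blast
next
  fix e :: real assume "e > 0"
  then show "\<exists>x\<in>{cost_block k m A B Ah Bh |Ah Bh X. feasible_block k m n Ah Bh X}. x < tail + e"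
    using approximately_attained by blast
qed

end

section \<open>Assembling the blocks\<close>

text \<open>Constraints and cost are separate for each i, so lower bounds add up and near-optimal
  points can be chosen independently. Each of the k blocks is allowed the error e / k.\<close>

lemma phi_eq_sum:
  assumes k: "k \<ge> 1"
    and lower: "\<And>i Ah Bh X. i \<in> {1..k} \<Longrightarrow> feasible_block k (m i) (n i) Ah Bh X \<Longrightarrow>
      v i \<le> cost_block k (m i) (A i) (B i) Ah Bh"
    and approx: "\<And>i e. i \<in> {1..k} \<Longrightarrow> e > 0 \<Longrightarrow> \<exists>Ah Bh X. feasible_block k (m i) (n i) Ah Bh X \<and>
      cost_block k (m i) (A i) (B i) Ah Bh < v i + e"
  shows "phi k m n A B = (\<Sum>i = 1..k. v i)"
  unfolding phi_def
proof (rule real_cInf_eq_approx)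
  fix x assume "x \<in> {cost k m A B Ah Bh |Ah Bh X. feasible k m n Ah Bh X}"
  then obtain Ah Bh X where x: "x = cost k m A B Ah Bh" and "feasible k m n Ah Bh X" by blast
  then show "(\<Sum>i = 1..k. v i) \<le> x"
    unfolding x cost_def feasible_def by (intro sum_mono lower) auto
next
  fix e :: real assume e: "e > 0"
  have "\<forall>i\<in>{1..k}. \<exists>Ah Bh X. feasible_block k (m i) (n i) Ah Bh X \<and>
      cost_block k (m i) (A i) (B i) Ah Bh < v i + e / real k"
    using approx e k by simp
  \<comment> \<open>The witnesses for the individual blocks are collected into functions of i, one
    quantifier at a time.\<close>
  from bchoice[OF this] obtain Ah where "\<forall>i\<in>{1..k}. \<exists>Bh X. feasible_block k (m i) (n i) (Ah i) Bh X \<and>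
      cost_block k (m i) (A i) (B i) (Ah i) Bh < v i + e / real k" by blast
  from bchoice[OF this] obtain Bh where "\<forall>i\<in>{1..k}. \<exists>X. feasible_block k (m i) (n i) (Ah i) (Bh i) X \<and>
      cost_block k (m i) (A i) (B i) (Ah i) (Bh i) < v i + e / real k" by blast
  from bchoice[OF this] obtain X where X: "\<forall>i\<in>{1..k}. feasible_block k (m i) (n i) (Ah i) (Bh i) (X i) \<and>
      cost_block k (m i) (A i) (B i) (Ah i) (Bh i) < v i + e / real k" by blast
  have "cost k m A B Ah Bh < (\<Sum>i = 1..k. v i + e / real k)"
    unfolding cost_def by (rule sum_strict_mono) (use X k in auto)
  also have "\<dots> = (\<Sum>i = 1..k. v i) + e" using k by (simp add: sum.distrib)
  finally have "cost k m A B Ah Bh < (\<Sum>i = 1..k. v i) + e" .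
  moreover have "feasible k m n Ah Bh X" unfolding feasible_def using X by blast
  ultimately show "\<exists>x\<in>{cost k m A B Ah Bh |Ah Bh X. feasible k m n Ah Bh X}. x < (\<Sum>i = 1..k. v i) + e"
    by blast
qed

theorem theorem5p2:
  fixes k :: nat and m n :: "nat \<Rightarrow> nat"
    and A :: "nat \<Rightarrow> complex mat" and B :: "nat \<Rightarrow> nat \<Rightarrow> complex mat"
    and U1 U2 V :: "nat \<Rightarrow> complex mat" and S1 S2 :: "nat \<Rightarrow> real mat"
  assumes "k \<ge> 1"
    and "\<And>i. i \<in> {1..k} \<Longrightarrow> m i \<ge> n i"
    and "\<And>i. i \<in> {1..k} \<Longrightarrow> A i \<in> carrier_mat (m i) (n i)"
    and "\<And>i s. i \<in> {1..k} \<Longrightarrow> s \<in> {1..k} \<Longrightarrow> B i s \<in> carrier_mat (m i) (n i)"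
    and "\<And>i. i \<in> {1..k} \<Longrightarrow>
      partitioned_svd k (m i) (n i) (aug k (m i) (A i) (B i)) (U1 i) (U2 i) (S1 i) (S2 i) (V i)"
  shows "phi k m n A B = (\<Sum>i = 1..k. phi_block k (m i) (n i) (A i) (B i)) \<and>
    (\<Sum>i = 1..k. phi_block k (m i) (n i) (A i) (B i)) =
      (\<Sum>i = 1..k. \<Sum>j = n i + 1..min (m i) ((k + 1) * n i).
         (singular_value (aug k (m i) (A i) (B i)) j)\<^sup>2) \<and>
    ((\<forall>i\<in>{1..k}. spectral_norm (V_block (n i) (V i) 1) < 1) \<longrightarrow>
      (let Ah = (\<lambda>i. U1 i * map_mat complex_of_real (S1 i) *
                   mat_adjoint (V_block (n i) (V i) 1));
           Bh = (\<lambda>i s. U1 i * map_mat complex_of_real (S1 i) *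
                   mat_adjoint (V_block (n i) (V i) (s + 1)))
       in \<exists>X. feasible k m n Ah Bh X \<and> cost k m A B Ah Bh = phi k m n A B))"
proof -
  define v where "v i = (\<Sum>j = n i + 1..min (m i) ((k + 1) * n i).
     (singular_value (aug k (m i) (A i) (B i)) j)\<^sup>2)" for i
  define Ah where "Ah i = U1 i * map_mat complex_of_real (S1 i) * mat_adjoint (V_block (n i) (V i) 1)" for i
  define Bh where "Bh i s = U1 i * map_mat complex_of_real (S1 i) * mat_adjoint (V_block (n i) (V i) (s + 1))"
    for i s
  have block: "svd_block k (m i) (n i) (A i) (B i) (U1 i) (U2 i) (V i) (S1 i) (S2 i)" if "i \<in> {1..k}" for i
    using that assms by unfold_locales auto
  have tail: "svd_block.tail k (m i) (n i) (A i) (B i) = v i" if "i \<in> {1..k}" for i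
    unfolding svd_block.tail_def[OF block[OF that]] v_def ..
  have phi_block: "phi_block k (m i) (n i) (A i) (B i) = v i" if "i \<in> {1..k}" for i
    using svd_block.phi_block_eq[OF block[OF that]] tail[OF that] by simp
  have phi: "phi k m n A B = (\<Sum>i = 1..k. v i)"
  proof (rule phi_eq_sum[OF assms(1)])
    show "v i \<le> cost_block k (m i) (A i) (B i) Ah Bh"
      if "i \<in> {1..k}" "feasible_block k (m i) (n i) Ah Bh X" for i Ah Bh X
      using svd_block.tail_le_cost_block[OF block that(2)] that(1) tail by simp
    show "\<exists>Ah Bh X. feasible_block k (m i) (n i) Ah Bh X \<and> cost_block k (m i) (A i) (B i) Ah Bh < v i + e"
      if "i \<in> {1..k}" "e > 0" for i e
      using svd_block.approximately_attained[OF block that(2)] that(1) tail by simp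
  qed
  have cost: "cost k m A B Ah Bh = (\<Sum>i = 1..k. v i)"
    unfolding cost_def
  proof (rule sum.cong[OF refl])
    fix i assume i: "i \<in> {1..k}"
    show "cost_block k (m i) (A i) (B i) (Ah i) (Bh i) = v i"
      using svd_block.cost_block_truncation[OF block[OF i]] tail[OF i]
      unfolding svd_block.P_def[OF block[OF i]] svd_block.W_def[OF block[OF i]] Ah_def Bh_def[abs_def] by simp
  qed
  \<comment> \<open>The cost of the candidate is already the right value; the norm condition
    supplies the matrices \<open>X\<close> block by block, and they are then chosen
    simultaneously.\<close>
  have "\<exists>X. feasible k m n Ah Bh X" if norm: "\<forall>i\<in>{1..k}. spectral_norm (V_block (n i) (V i) 1) < 1"
  proof -
    have "\<forall>i\<in>{1..k}. \<exists>X. feasible_block k (m i) (n i) (Ah i) (Bh i) X"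
    proof
      fix i assume i: "i \<in> {1..k}"
      then show "\<exists>X. feasible_block k (m i) (n i) (Ah i) (Bh i) X"
        using svd_block.attained[OF block[OF i]] norm
        unfolding svd_block.P_def[OF block[OF i]] svd_block.W_def[OF block[OF i]] Ah_def Bh_def[abs_def] by simp
    qed
    from bchoice[OF this] show ?thesis unfolding feasible_def by blast
  qed
  then show ?thesis
    using phi phi_block cost unfolding Ah_def[abs_def] Bh_def[abs_def] v_def Let_def by simp
qed

end
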